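(* Let $k\ge 1$ be an integer, put $n=2^k-1$, and let $H$ be a $k\times n$ parity check matrix over $\mathbb{F}_2$ of a binary cyclic Hamming code of length $n$. For $i\ge 1$ let $H_i$ be the matrix obtained from $H$ by cyclically shifting its columns $i$ times to the right. Let $c$ be an integer with $1\le c\le n-2$, let $C\subseteq\mathbb{F}_2^{(c+3)n}$ be the binary linear code with parity check matrix $$\begin{bmatrix} H & 0 & H & H & \cdots & H\\ 0 & H & H & H_1 & \cdots & H_c\end{bmatrix},$$ where $0$ is the $k\times n$ zero matrix, and let $C^*$ be the extended code of $C$. Then $C^*$ is a completely regular code if and only if $c=2^{k-1}-2$. In this case, $C^*$ is a $[2^{k-1}(2^k+1),\ 2^{k-1}(2^k+1)-1-2k,\ 4;\ 3]$ code with intersection array $$\{2^{k-1}(2^k+1),\ 2^{k-1}(2^k+1)-1,\ 2^{2k-2};\ 1,\ 2^{k-1}(2^{k-1}+1),\ 2^{k-1}(2^k+1)\}.$$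
   Context: A binary Hamming code of length $n=2^k-1$ is a linear code with a $k\times n$ parity check matrix whose columns are all the nonzero vectors of $\mathbb{F}_2^k$, each occurring once; it is cyclic if it is invariant under the cyclic shift of coordinates $(x_1,\ldots,x_n)\mapsto(x_n,x_1,\ldots,x_{n-1})$. The code with parity check matrix $P$ is $\{x: Px^T=0\}$. The extended code $C^*$ is obtained by adding an extra coordinate to each codeword of $C$ such that the sum of the coordinates of the extended vector is zero. Distances are Hamming distances. For a code $D\subseteq\mathbb{F}_2^N$, $d(x,D)=\min_{y\in D}d(x,y)$; the covering radius is $\rho=\max_x d(x,D)$; an $[N,K,d;\rho]$ code is a binary linear code of length $N$, dimension $K$, minimum distance $d$ and covering radius $\rho$. Let $D(i)=\{x\in\mathbb{F}_2^N: d(x,D)=i\}$ for $0\le i\le\rho$. Two vectors are neighbors if they are at distance $1$. $D$ is completely regular if for every $l\in\{0,\ldots,\rho\}$ every $x\in D(l)$ has the same number $c_l$ of neighbors in $D(l-1)$ and the same number $b_l$ of neighbors in $D(l+1)$ (with $c_0=b_\rho=0$). Its intersection array is $\{b_0,\ldots,b_{\rho-1};c_1,\ldots,c_\rho\}$. *)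

theory Defs
  imports
    "HOL-Library.Z2"
    "Jordan_Normal_Form.Matrix_Kernel"
begin

section \<open>Hamming distance, covering radius, code parameters\<close>

definition hdist :: "bit vec \<Rightarrow> bit vec \<Rightarrow> nat" where
  "hdist x y = card {i. i < dim_vec x \<and> x $ i \<noteq> y $ i}"

definition dist_code :: "bit vec \<Rightarrow> bit vec set \<Rightarrow> nat" where
  "dist_code x D = Min (hdist x ` D)"

definition covering_radius :: "nat \<Rightarrow> bit vec set \<Rightarrow> nat" where
  "covering_radius N D = Max ((\<lambda>x. dist_code x D) ` carrier_vec N)"

definition minimum_distance :: "bit vec set \<Rightarrow> nat" where
  "minimum_distance D = Min {hdist x y | x y. x \<in> D \<and> y \<in> D \<and> x \<noteq> y}"

text \<open>The parameters \<open>[N, K, d; \<rho>]\<close> of a binary linear code \<open>D\<close>.\<close>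

definition linear_code_params ::
    "bit vec set \<Rightarrow> nat \<Rightarrow> nat \<Rightarrow> nat \<Rightarrow> nat \<Rightarrow> bool" where
  "linear_code_params D N K d \<rho> \<longleftrightarrow>
     subspace class_ring D (module_vec TYPE(bit) N) \<and>
     vectorspace.dim class_ring ((module_vec TYPE(bit) N)\<lparr>carrier := D\<rparr>) = K \<and>
     minimum_distance D = d \<and>
     covering_radius N D = \<rho>"

section \<open>Completely regular codes\<close>

text \<open>\<open>layer N D i\<close> is the set \<open>D(i)\<close>.\<close>

definition layer :: "nat \<Rightarrow> bit vec set \<Rightarrow> nat \<Rightarrow> bit vec set" where
  "layer N D i = {x \<in> carrier_vec N. dist_code x D = i}"

definition intersection_numbers ::
    "nat \<Rightarrow> bit vec set \<Rightarrow> (nat \<Rightarrow> nat) \<Rightarrow> (nat \<Rightarrow> nat) \<Rightarrow> bool" where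
  "intersection_numbers N D b c \<longleftrightarrow>
     c 0 = 0 \<and> b (covering_radius N D) = 0 \<and>
     (\<forall>l \<le> covering_radius N D. \<forall>x \<in> layer N D l.
        (l > 0 \<longrightarrow> card {y \<in> layer N D (l - 1). hdist x y = 1} = c l) \<and>
        (l < covering_radius N D \<longrightarrow> card {y \<in> layer N D (l + 1). hdist x y = 1} = b l))"

definition completely_regular :: "nat \<Rightarrow> bit vec set \<Rightarrow> bool" where
  "completely_regular N D \<longleftrightarrow> (\<exists>b c. intersection_numbers N D b c)"

text \<open>The array \<open>{b\<^sub>0, \<dots>, b\<^sub>\<rho>\<^sub>-\<^sub>1; c\<^sub>1, \<dots>, c\<^sub>\<rho>}\<close> is given by two lists
  of length \<open>\<rho>\<close>.\<close>

definition has_intersection_array ::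
    "nat \<Rightarrow> bit vec set \<Rightarrow> nat list \<Rightarrow> nat list \<Rightarrow> bool" where
  "has_intersection_array N D bs cs \<longleftrightarrow>
     (\<exists>b c. intersection_numbers N D b c \<and>
            bs = map b [0..<covering_radius N D] \<and>
            cs = map c [1..<covering_radius N D + 1])"

section \<open>Cyclic Hamming codes\<close>

text \<open>The code with parity check matrix \<open>P\<close> is \<open>mat_kernel P\<close>.\<close>

definition hamming_code :: "nat \<Rightarrow> bit vec set \<Rightarrow> bool" where
  "hamming_code k D \<longleftrightarrow>
     (\<exists>P \<in> carrier_mat k (2 ^ k - 1).
        distinct (cols P) \<and> set (cols P) = carrier_vec k - {0\<^sub>v k} \<and> D = mat_kernel P)"

definition cyclic_shift :: "'a vec \<Rightarrow> 'a vec" where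
  "cyclic_shift x = vec (dim_vec x) (\<lambda>j. x $ (if j = 0 then dim_vec x - 1 else j - 1))"

definition cyclic_code :: "bit vec set \<Rightarrow> bool" where
  "cyclic_code D \<longleftrightarrow> cyclic_shift ` D = D"

section \<open>The construction\<close>

definition shift_cols :: "'a mat \<Rightarrow> 'a mat" where
  "shift_cols A = mat (dim_row A) (dim_col A)
     (\<lambda>(r, j). A $$ (r, if j = 0 then dim_col A - 1 else j - 1))"

text \<open>The block matrix, assembled from left to right out of its block columns;
  \<open>(shift_cols ^^ i) H\<close> is \<open>H\<^sub>i\<close>.\<close>

definition block_parity_check :: "bit mat \<Rightarrow> nat \<Rightarrow> bit mat" where
  "block_parity_check H c =
     (let Z = 0\<^sub>m (dim_row H) (dim_col H) in
      mat_of_cols (2 * dim_row H) (concat (map cols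
        ([H @\<^sub>r Z, Z @\<^sub>r H, H @\<^sub>r H] @
         map (\<lambda>i. H @\<^sub>r (shift_cols ^^ i) H) [1..<c + 1]))))"

definition extended_code :: "bit vec set \<Rightarrow> bit vec set" where
  "extended_code D =
     {y. \<exists>x \<in> D. \<exists>a. y = x @\<^sub>v vec_of_list [a] \<and> (\<Sum>i<dim_vec y. y $ i) = 0}"

end

theory Submission
  imports Defs
begin

text \<open>
  The columns of the block matrix are the nonzero vectors of \<open>c + 3\<close> subspaces of dimension \<open>k\<close> of
  a space \<open>V\<close> of dimension \<open>2k\<close> over the two-element field that meet pairwise in \<open>0\<close>: cyclicity makes
  the set of pairs of corresponding columns of \<open>H\<close> and \<open>H\<^sub>i\<close>, together with \<open>0\<close>, closed under
  addition. Let \<open>U\<close> be the union of these subspaces. A syndrome of the extended code is a pair of a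
  parity bit and a vector \<open>g\<close> of \<open>V\<close>; since \<open>U + U = V\<close>, its coset has distance \<open>0\<close> or \<open>2\<close> from
  the code if the parity is even (according to \<open>g = 0\<close> or not), and \<open>1\<close> or \<open>3\<close> if it is odd
  (according to \<open>g \<in> U\<close> or not). All intersection numbers are then automatically constant except
  \<open>c\<^sub>2 = |{s \<in> U. g + s \<in> U}|\<close> and \<open>b\<^sub>2\<close>, so complete regularity means that this count does not
  depend on \<open>g \<noteq> 0\<close>. With \<open>t = c + 3\<close> subspaces the count is \<open>2^k + (t - 1)(t - 2)\<close> for \<open>g \<in> U\<close>
  and \<open>t(t - 1)\<close> for \<open>g \<notin> U\<close>, and these agree iff \<open>t = 2^(k - 1) + 1\<close>.
\<close>

text \<open>These simp rules turn ring operations on bits into bitwise ones, which hides them from ring lemmas.\<close>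

declare add_bit_eq_xor [simp del] mult_bit_eq_and [simp del] minus_bit_def [simp del]
  uminus_bit_def [simp del]

section \<open>Bits and bit vectors\<close>

lemma bit_add_self [simp]: "(b::bit) + b = 0"
  by (cases b) (simp_all add: one_add_one)

lemma bit_add_eq: "(a::bit) + b = of_bool (a \<noteq> b)"
  by (cases a; cases b) simp_all

lemma of_nat_bit_eq_0_iff: "of_nat n = (0::bit) \<longleftrightarrow> even n"
  by (induction n) (auto simp: bit_add_eq)

lemma bit_vec_add_self [simp]: "v + v = (0\<^sub>v (dim_vec v) :: bit vec)"
  by (intro eq_vecI) auto

lemma bit_vec_add_self_left:
  assumes "u \<in> carrier_vec m" "v \<in> carrier_vec m"
  shows "u + (u + v) = (v :: bit vec)"
  using assms by (simp flip: assoc_add_vec[of u m])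

lemma bit_vec_add_eq_0_iff:
  assumes "u \<in> carrier_vec m" "v \<in> carrier_vec m"
  shows "u + v = (0\<^sub>v m :: bit vec) \<longleftrightarrow> u = v"
  using assms bit_vec_add_self_left[of u m v] by auto

lemma bit_vec_add_eq_iff:
  assumes "u \<in> carrier_vec m" "v \<in> carrier_vec m" "w \<in> carrier_vec m"
  shows "u + v = (w :: bit vec) \<longleftrightarrow> v = u + w"
  using assms bit_vec_add_self_left[of u m] by auto

lemma bij_betw_support:
  "bij_betw (\<lambda>v. {i. i < n \<and> v $ i = (1::bit)}) (carrier_vec n) (Pow {..<n})"
proof (rule bij_betw_byWitness[where f' = "\<lambda>I. vec n (\<lambda>i. if i \<in> I then 1 else 0)"])
  show "\<forall>v\<in>carrier_vec n. vec n (\<lambda>i. if i \<in> {i. i < n \<and> v $ i = (1::bit)} then 1 else 0) = v"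
    by (auto intro!: eq_vecI)
qed (auto split: if_splits)

lemma finite_carrier_vec_bit [simp]: "finite (carrier_vec n :: bit vec set)"
  using bij_betw_finite[OF bij_betw_support[of n]] by simp

lemma card_carrier_vec_bit: "card (carrier_vec n :: bit vec set) = 2 ^ n"
  using bij_betw_same_card[OF bij_betw_support[of n]] by (simp add: card_Pow)

lemma mat_mult_unit_vec:
  fixes A :: "'a :: comm_ring_1 mat"
  assumes "A \<in> carrier_mat m n" "j < n"
  shows "A *\<^sub>v unit_vec n j = col A j"
  using assms by (intro eq_vecI) (auto simp: scalar_prod_right_unit)

section \<open>Hamming distance\<close>

lemma hdist_self [simp]: "hdist x x = 0"
  by (simp add: hdist_def)

lemma hdist_eq_0_iff:
  assumes "x \<in> carrier_vec N" "y \<in> carrier_vec N"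
  shows "hdist x y = 0 \<longleftrightarrow> x = y"
  using assms by (auto simp: hdist_def)

lemma hdist_le:
  assumes "x \<in> carrier_vec N"
  shows "hdist x y \<le> N"
proof -
  have "hdist x y \<le> card {..<N}"
    unfolding hdist_def using assms by (intro card_mono) auto
  then show ?thesis by simp
qed

lemma hdist_triangle:
  assumes "x \<in> carrier_vec N" "y \<in> carrier_vec N"
  shows "hdist x z \<le> hdist x y + hdist y z"
proof -
  have "hdist x z \<le> card ({i. i < dim_vec x \<and> x $ i \<noteq> y $ i} \<union> {i. i < dim_vec y \<and> y $ i \<noteq> z $ i})"
    unfolding hdist_def using assms by (intro card_mono) auto
  also have "\<dots> \<le> hdist x y + hdist y z"
    unfolding hdist_def by (rule card_Un_le)
  finally show ?thesis .
qed

lemma hdist_add_unit_vec: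
  assumes "x \<in> carrier_vec N" "j < N"
  shows "hdist x (x + unit_vec N j) = 1"
proof -
  have "{i. i < dim_vec x \<and> x $ i \<noteq> (x + unit_vec N j) $ i} = {j}"
    using assms by (auto split: if_splits)
  then show ?thesis by (simp add: hdist_def)
qed

text \<open>Flipping a coordinate of disagreement removes exactly that coordinate from the set
  counted by \<open>hdist\<close>. This peels a distance off one unit vector at a time.\<close>

lemma hdist_SucE:
  assumes "x \<in> carrier_vec N" "y \<in> carrier_vec N" "hdist x y = Suc d"
  obtains j where "j < N" "x $ j \<noteq> y $ j" "hdist (x + unit_vec N j) y = d"
proof -
  let ?I = "{i. i < dim_vec x \<and> x $ i \<noteq> y $ i}"
  have c: "card ?I = Suc d" using assms by (simp add: hdist_def)
  then obtain j where j: "j \<in> ?I" by (metis card.empty ex_in_conv nat.distinct(1))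
  have flip: "(x + unit_vec N j) $ i \<noteq> y $ i \<longleftrightarrow> x $ i \<noteq> y $ i \<and> i \<noteq> j" if "i < N" for i
    using that j assms by (cases "x $ i"; cases "y $ i"; cases "i = j") auto
  have "{i. i < dim_vec (x + unit_vec N j) \<and> (x + unit_vec N j) $ i \<noteq> y $ i} = ?I - {j}"
  proof (rule Set.set_eqI)
    fix i
    show "i \<in> {i. i < dim_vec (x + unit_vec N j) \<and> (x + unit_vec N j) $ i \<noteq> y $ i} \<longleftrightarrow> i \<in> ?I - {j}"
      \<comment> \<open>With \<open>index_add_vec(1)\<close> active, the entry of the sum would be
        split and \<open>flip\<close> would no longer match.\<close>
      using flip[of i] assms by (cases "i < N") (simp_all del: index_add_vec(1))
  qed
  then have "hdist (x + unit_vec N j) y = d"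
    using c j by (simp add: hdist_def card_Diff_singleton)
  then show thesis using that[of j] j assms by auto
qed

lemma hdist_eq_1_iff:
  assumes "x \<in> carrier_vec N" "y \<in> carrier_vec N"
  shows "hdist x y = 1 \<longleftrightarrow> (\<exists>j<N. y = x + unit_vec N j)"
proof
  assume "hdist x y = 1"
  then obtain j where "j < N" "hdist (x + unit_vec N j) y = 0"
    using assms by (metis One_nat_def hdist_SucE)
  then show "\<exists>j<N. y = x + unit_vec N j"
    using assms hdist_eq_0_iff[of "x + unit_vec N j" N y] by auto
qed (use assms hdist_add_unit_vec in auto)

lemma sum_add_unit_vec:
  assumes "x \<in> carrier_vec N" "j < N"
  shows "(\<Sum>i<N. (x + unit_vec N j) $ i) = (\<Sum>i<N. x $ i) + (1::bit)"
proof -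
  have "(\<Sum>i<N. (x + unit_vec N j) $ i) = (\<Sum>i<N. x $ i + (if i = j then 1 else 0))"
    using assms by (intro sum.cong) auto
  then show ?thesis using assms by (simp add: sum.distrib)
qed

text \<open>Modulo two, the number of disagreements is the sum of all entries of both vectors: equal
  entries cancel and unequal ones contribute 1.\<close>

lemma even_hdist_iff:
  assumes "x \<in> carrier_vec N" "y \<in> carrier_vec N"
  shows "even (hdist x y) \<longleftrightarrow> (\<Sum>i<N. x $ i) = (\<Sum>i<N. y $ i)"
proof -
  have "(\<Sum>i<N. x $ i) + (\<Sum>i<N. y $ i) = (\<Sum>i<N. if x $ i \<noteq> y $ i then 1 else 0)"
    unfolding sum.distrib[symmetric] by (intro sum.cong) (auto simp: bit_add_eq)
  also have "\<dots> = of_nat (hdist x y)"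
    using assms by (simp add: sum.If_cases hdist_def Int_def lessThan_def)
  finally have "even (hdist x y) \<longleftrightarrow> (\<Sum>i<N. x $ i) + (\<Sum>i<N. y $ i) = 0"
    by (simp only: of_nat_bit_eq_0_iff)
  also have "\<dots> \<longleftrightarrow> (\<Sum>i<N. x $ i) = (\<Sum>i<N. y $ i)"
    by (simp add: bit_add_eq)
  finally show ?thesis .
qed

section \<open>Dimension of a kernel\<close>

text \<open>Rank-nullity: surjectivity makes the rank equal to the number of rows.\<close>

lemma mat_kernel_subspace:
  fixes A :: "'a :: field mat"
  assumes A: "A \<in> carrier_mat nr nc"
    and surj: "(*\<^sub>v) A ` carrier_vec nc = carrier_vec nr"
  shows "subspace class_ring (mat_kernel A) (module_vec TYPE('a) nc)"
    and "vectorspace.dim class_ring ((module_vec TYPE('a) nc)\<lparr>carrier := mat_kernel A\<rparr>) = nc - nr"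
proof -
  interpret V: vec_space "TYPE('a)" nc .
  interpret W: vec_space "TYPE('a)" nr .
  have hom: "(*\<^sub>v) A \<in> LinearCombinations.module_hom class_ring (module_vec TYPE('a) nc) (module_vec TYPE('a) nr)"
    unfolding LinearCombinations.module_hom_def
    using A mult_add_distrib_mat_vec[OF A] mult_mat_vec[OF A] by (simp add: module_vec_simps)
  interpret linear_map class_ring "module_vec TYPE('a) nc" "module_vec TYPE('a) nr" "(*\<^sub>v) A"
    by unfold_locales (rule hom)
  have ker: "kerT = mat_kernel A"
    using A by (auto simp: ker_def mat_kernel_def module_vec_simps)
  have im: "imT = carrier_vec nr"
    using surj by (simp add: im_def module_vec_simps)
  \<comment> \<open>\<open>rank_nullity\<close> treats the image as a space with replaced carrier,
    which here is the whole codomain.\<close>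
  have vW: "W.V\<lparr>carrier := carrier_vec nr\<rparr> = W.V"
    by (simp add: module_vec_def)
  show "subspace class_ring (mat_kernel A) (module_vec TYPE('a) nc)"
    using kerT_is_subspace ker by simp
  show "vectorspace.dim class_ring (V.V\<lparr>carrier := mat_kernel A\<rparr>) = nc - nr"
    using rank_nullity[OF V.fin_dim] V.dim_is_n W.dim_is_n by (simp add: ker im vW)
qed

section \<open>Codes with distinct parity checks, extended by an overall parity bit\<close>

text \<open>The distances from \<open>x\<close> are bounded by \<open>N\<close>, so the
  \<open>Min\<close> in \<open>dist_code\<close> ranges over a finite set.\<close>

lemma dist_code_eqI:
  assumes x: "x \<in> carrier_vec N" and z: "z \<in> D" "hdist x z \<le> d"
    and lower: "\<And>z'. z' \<in> D \<Longrightarrow> d \<le> hdist x z'"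
  shows "dist_code x D = d"
proof -
  have "finite (hdist x ` D)"
    by (rule finite_subset[of _ "{..N}"]) (use hdist_le[OF x] in auto)
  moreover have "d \<in> hdist x ` D"
    using z lower[OF z(1)] by (metis imageI le_antisym)
  ultimately show ?thesis
    unfolding dist_code_def using lower by (intro Min_eqI) auto
qed

text \<open>The abstract setting of an extended code: \<open>zero_T\<close> reflects the column of
  the parity coordinate, \<open>sumset\<close> brings every syndrome within reach of two columns,
  and \<open>proper\<close> provides a syndrome that no single column reaches.\<close>

locale parity_extension =
  fixes m N :: nat and M :: "bit mat" and T :: "bit vec set" and D :: "bit vec set"
  assumes M: "M \<in> carrier_mat m N"
    and distinct: "distinct (cols M)"
    and T: "T = set (cols M)"
    and zero_T: "0\<^sub>v m \<in> T"
    and sumset: "\<And>g. g \<in> carrier_vec m \<Longrightarrow> \<exists>s\<in>T. \<exists>t\<in>T. g = s + t"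
    and proper: "T \<noteq> carrier_vec m"
    and D: "D = {x \<in> carrier_vec N. M *\<^sub>v x = 0\<^sub>v m \<and> (\<Sum>i<N. x $ i) = 0}"
begin

abbreviation par :: "bit vec \<Rightarrow> bit" where
  "par x \<equiv> \<Sum>i<N. x $ i"

definition level :: "bit \<Rightarrow> bit vec \<Rightarrow> nat" where
  "level p s = (if p = 0 then if s = 0\<^sub>v m then 0 else 2 else if s \<in> T then 1 else 3)"

text \<open>In characteristic two this counts, for \<open>g\<close> in the ambient space, the
  ordered representations g = s + t with both summands in \<open>T\<close>.\<close>

definition reps :: "bit vec \<Rightarrow> nat" where
  "reps g = card {t \<in> T. g + t \<in> T}"

lemma level_eq_iff:
  "level p s = 0 \<longleftrightarrow> p = 0 \<and> s = 0\<^sub>v m"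
  "level p s = Suc 0 \<longleftrightarrow> p \<noteq> 0 \<and> s \<in> T"
  "level p s = 2 \<longleftrightarrow> p = 0 \<and> s \<noteq> 0\<^sub>v m"
  "level p s = 3 \<longleftrightarrow> p \<noteq> 0 \<and> s \<notin> T"
  by (simp_all add: level_def)

lemma T_eq: "T = col M ` {..<N}"
  using M by (simp add: T cols_def atLeast0LessThan)

lemma inj_col: "inj_on (col M) {..<N}"
  using distinct M by (simp add: cols_def distinct_map atLeast0LessThan)

lemma dim_row_M [simp]: "dim_row M = m"
  using M by simp

lemma card_T: "card T = N"
  using inj_col by (simp add: T_eq card_image)

lemma finite_T: "finite T"
  by (simp add: T)

lemma T_carrier: "T \<subseteq> carrier_vec m"
  using M cols_dim[of M] by (simp add: T)

lemma col_carrier [simp]: "col M j \<in> carrier_vec m"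
  using M col_dim[of M j] by simp

lemma syn_carrier [simp]: "M *\<^sub>v x \<in> carrier_vec m"
  using M by (intro carrier_vecI) simp

lemma syn_add_unit_vec:
  assumes "x \<in> carrier_vec N" "j < N"
  shows "M *\<^sub>v (x + unit_vec N j) = M *\<^sub>v x + col M j"
  using assms M by (simp add: mult_add_distrib_mat_vec[OF M] mat_mult_unit_vec)

lemma zero_in_D: "0\<^sub>v N \<in> D"
  using M by (auto simp: D)

lemma D_carrier: "D \<subseteq> carrier_vec N"
  by (auto simp: D)

lemma obtain_two_columns:
  assumes "g \<in> carrier_vec m"
  obtains i j where "i < N" "j < N" "g = col M i + col M j"
  using sumset[OF assms] unfolding T_eq by auto

lemma even_hdist_D:
  assumes "x \<in> carrier_vec N" "z \<in> D"
  shows "even (hdist x z) \<longleftrightarrow> par x = 0"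
  using even_hdist_iff[of x N z] assms by (simp add: D)

text \<open>The parity of \<open>x\<close> fixes the parity of its distance to every codeword, so
  excluding distance 0 or 1 already raises the lower bound to 2 or 3. The upper bounds come from
  flipping at most three suitable coordinates.\<close>

lemma dist_code_D:
  assumes x: "x \<in> carrier_vec N"
  shows "dist_code x D = level (par x) (M *\<^sub>v x)"
proof -
  let ?s = "M *\<^sub>v x"
  have d0: "?s = 0\<^sub>v m" if "z \<in> D" "hdist x z = 0" for z
    using that x hdist_eq_0_iff[of x N z] by (simp add: D)
  have d1: "?s \<in> T" if z: "z \<in> D" and h: "hdist x z = 1" for z
  proof -
    obtain j where j: "j < N" "z = x + unit_vec N j"
      using h hdist_eq_1_iff[of x N z] x z D_carrier by auto
    then have "?s + col M j = 0\<^sub>v m"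
      using z syn_add_unit_vec[OF x j(1)] by (simp add: D)
    then show ?thesis using j(1) by (auto simp: T_eq bit_vec_add_eq_0_iff)
  qed
  obtain i j where ij: "i < N" "j < N" "?s = col M i + col M j"
    using obtain_two_columns[of ?s] by auto
  \<comment> \<open>Flipping the coordinate of the zero column changes the parity and leaves the
    syndrome alone.\<close>
  obtain l where l: "l < N" "col M l = 0\<^sub>v m"
    using zero_T by (auto simp: T_eq)
  \<comment> \<open>The two flips cancel the syndrome and preserve the parity. The indices may
    coincide, hence only an upper bound on the distance to \<open>x\<close>.\<close>
  define y where "y = x + unit_vec N i + unit_vec N j"
  have y: "y \<in> carrier_vec N" using x by (simp add: y_def)
  have xy: "hdist x y \<le> 2"
    using hdist_triangle[of x N "x + unit_vec N i" y] x ij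
      hdist_add_unit_vec[of x N i] hdist_add_unit_vec[of "x + unit_vec N i" N j]
    by (simp add: y_def)
  have syn_y: "M *\<^sub>v y = 0\<^sub>v m"
  proof -
    have "M *\<^sub>v y = ?s + col M i + col M j"
      using x ij(1,2) by (simp add: y_def syn_add_unit_vec del: assoc_add_vec)
    also have "\<dots> = ?s + (col M i + col M j)" by (rule assoc_add_vec[of _ m]) auto
    finally show ?thesis using M by (simp flip: ij(3))
  qed
  have par_y: "par y = par x"
    using x ij sum_add_unit_vec[of x N i] sum_add_unit_vec[of "x + unit_vec N i" N j]
    by (simp add: y_def add.assoc del: index_add_vec(1))
  consider "par x = 0" "?s = 0\<^sub>v m" | "par x = 0" "?s \<noteq> 0\<^sub>v m"
    | "par x \<noteq> 0" "?s \<in> T" | "par x \<noteq> 0" "?s \<notin> T"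
    by blast
  then show ?thesis
  proof cases
    case 1
    then have "dist_code x D = 0"
      using x by (intro dist_code_eqI[of x N x]) (auto simp: D)
    then show ?thesis using 1 by (simp add: level_def)
  next
    case 2
    have "dist_code x D = 2"
    proof (rule dist_code_eqI[OF x _ xy])
      show "y \<in> D" using y syn_y par_y 2(1) by (simp add: D)
      show "2 \<le> hdist x z" if "z \<in> D" for z
      proof -
        have "even (hdist x z)" "hdist x z \<noteq> 0"
          using 2 d0[OF that] even_hdist_D[OF x that] by auto
        then show ?thesis by presburger
      qed
    qed
    then show ?thesis using 2 by (simp add: level_def)
  next
    case 3
    then obtain r where r: "r < N" "?s = col M r" by (auto simp: T_eq)
    have "dist_code x D = 1"
    proof (rule dist_code_eqI[OF x])
      show "x + unit_vec N r \<in> D"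
        using 3(1) x r M sum_add_unit_vec[OF x r(1)]
        by (simp add: D syn_add_unit_vec del: index_add_vec(1))
      show "hdist x (x + unit_vec N r) \<le> 1"
        using hdist_add_unit_vec[OF x r(1)] by simp
      show "1 \<le> hdist x z" if "z \<in> D" for z
        using 3(1) even_hdist_D[OF x that] by (cases "hdist x z") auto
    qed
    then show ?thesis using 3 by (simp add: level_def)
  next
    case 4
    have "dist_code x D = 3"
    proof (rule dist_code_eqI[OF x])
      show "y + unit_vec N l \<in> D"
        using 4(1) y l M syn_y par_y sum_add_unit_vec[OF y l(1)]
        by (simp add: D syn_add_unit_vec del: index_add_vec(1))
      show "hdist x (y + unit_vec N l) \<le> 3"
        using xy hdist_triangle[OF x y, of "y + unit_vec N l"] hdist_add_unit_vec[OF y l(1)] by simp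
      show "3 \<le> hdist x z" if "z \<in> D" for z
      proof -
        have "odd (hdist x z)" "hdist x z \<noteq> 1"
          using 4 d1[OF that] even_hdist_D[OF x that] by auto
        then show ?thesis by presburger
      qed
    qed
    then show ?thesis using 4 by (simp add: level_def)
  qed
qed

text \<open>Two flips of the zero vector realise the syndrome with even parity; a flip at the zero
  column corrects the parity if needed.\<close>

lemma ex_par_syn:
  assumes g: "g \<in> carrier_vec m"
  obtains x where "x \<in> carrier_vec N" "par x = p" "M *\<^sub>v x = g"
proof -
  obtain i j where ij: "i < N" "j < N" "g = col M i + col M j"
    using obtain_two_columns[OF g] by auto
  obtain l where l: "l < N" "col M l = 0\<^sub>v m"
    using zero_T by (auto simp: T_eq)
  \<comment> \<open>The explicit summand \<open>0\<^sub>v N\<close> gives both flips the form that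
    \<open>sum_add_unit_vec\<close> expects.\<close>
  define y :: "bit vec" where "y = 0\<^sub>v N + unit_vec N i + unit_vec N j"
  have y: "y \<in> carrier_vec N" by (simp add: y_def)
  have par_y: "par y = 0"
    using ij sum_add_unit_vec[of "0\<^sub>v N" N i] sum_add_unit_vec[of "0\<^sub>v N + unit_vec N i" N j]
    by (simp add: y_def add.assoc del: index_add_vec(1) left_zero_vec)
  have syn_y: "M *\<^sub>v y = g"
    using ij M by (simp add: y_def syn_add_unit_vec mat_mult_unit_vec del: index_add_vec(1))
  show thesis
  proof (cases "p = 0")
    case True
    then show thesis using that[of y] y par_y syn_y by simp
  next
    case False
    then show thesis
      using that[of "y + unit_vec N l"] y par_y syn_y l g sum_add_unit_vec[OF y l(1)]
      by (simp add: syn_add_unit_vec del: index_add_vec(1))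
  qed
qed

section \<open>Covering radius and intersection numbers\<close>

lemma ex_not_T: obtains g where "g \<in> carrier_vec m" "g \<notin> T"
  using proper T_carrier by auto

lemma covering_radius_D: "covering_radius N D = 3"
proof -
  obtain g x where g: "g \<notin> T" "x \<in> carrier_vec N" "par x = 1" "M *\<^sub>v x = g"
    using ex_not_T ex_par_syn[of _ 1] by metis
  then have "dist_code x D = 3" by (simp add: dist_code_D level_def)
  then have "3 \<in> (\<lambda>x. dist_code x D) ` carrier_vec N" using g(2) by (metis imageI)
  then show ?thesis
    unfolding covering_radius_def by (intro Max_eqI) (auto simp: dist_code_D level_def)
qed

text \<open>Flipping coordinate \<open>j\<close> changes the parity by 1 and the syndrome by
  \<open>col M j\<close>. As the columns are distinct, counting neighbours amounts to counting
  elements of \<open>T\<close>.\<close>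

lemma card_neighbours:
  assumes x: "x \<in> carrier_vec N"
  shows "card {y \<in> layer N D l. hdist x y = 1} = card {t \<in> T. level (par x + 1) (M *\<^sub>v x + t) = l}"
proof -
  let ?J = "{j. j < N \<and> level (par x + 1) (M *\<^sub>v x + col M j) = l}"
  have lev: "dist_code (x + unit_vec N j) D = level (par x + 1) (M *\<^sub>v x + col M j)" if "j < N" for j
    using that x by (simp add: dist_code_D sum_add_unit_vec syn_add_unit_vec del: index_add_vec(1))
  have "{y \<in> layer N D l. hdist x y = 1} = (\<lambda>j. x + unit_vec N j) ` ?J"
    using x hdist_add_unit_vec[OF x] hdist_eq_1_iff[OF x] lev by (auto simp: layer_def)
  moreover have "inj_on (\<lambda>j. x + unit_vec N j) ?J"
  proof (rule inj_onI)
    fix i j assume ij: "i \<in> ?J" "j \<in> ?J" "x + unit_vec N i = x + unit_vec N j"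
    then have "unit_vec N i = (unit_vec N j :: bit vec)"
      using x bit_vec_add_self_left[of x N] by (metis unit_vec_carrier)
    then show "i = j" using ij by simp
  qed
  moreover have "{t \<in> T. level (par x + 1) (M *\<^sub>v x + t) = l} = col M ` ?J"
    by (auto simp: T_eq)
  moreover have "inj_on (col M) ?J"
    using inj_col by (rule inj_on_subset) auto
  ultimately show ?thesis by (simp add: card_image)
qed

lemma card_not_reps: "card {t \<in> T. g + t \<notin> T} = N - reps g"
proof -
  have "{t \<in> T. g + t \<notin> T} = T - {t \<in> T. g + t \<in> T}" by auto
  then show ?thesis
    unfolding reps_def card_T[symmetric] using finite_T by (simp add: card_Diff_subset)
qed

text \<open>A vector of even parity with syndrome \<open>g\<close> lies in layer 2, and its
  neighbours in layer 1 correspond to the \<open>t\<close> in \<open>T\<close> with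
  \<open>g + t\<close> in \<open>T\<close>.\<close>

lemma reps_of_intersection_numbers:
  assumes ir: "intersection_numbers N D b c" and g: "g \<in> carrier_vec m" "g \<noteq> 0\<^sub>v m"
  shows "reps g = c 2"
proof -
  obtain x where x: "x \<in> carrier_vec N" "par x = 0" "M *\<^sub>v x = g"
    using ex_par_syn[OF g(1)] by metis
  then have l: "x \<in> layer N D 2" using g(2) by (simp add: layer_def dist_code_D level_def)
  have "\<forall>l\<le>3. \<forall>x\<in>layer N D l. 0 < l \<longrightarrow> card {y \<in> layer N D (l - 1). hdist x y = 1} = c l"
    using ir unfolding intersection_numbers_def covering_radius_D by blast
  from this[rule_format, of 2 x] l have "card {y \<in> layer N D 1. hdist x y = 1} = c 2" by simp
  then have "card {t \<in> T. level (par x + 1) (M *\<^sub>v x + t) = 1} = c 2"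
    using card_neighbours[OF x(1), of 1] by simp
  moreover have "{t \<in> T. level (par x + 1) (M *\<^sub>v x + t) = 1} = {t \<in> T. g + t \<in> T}"
    using x(2,3) by (auto simp: level_eq_iff)
  ultimately show ?thesis by (simp add: reps_def)
qed

text \<open>Only the entries at layer 2 depend on the structure of \<open>T\<close>. From layer 1
  exactly one column, the syndrome itself, leads into the code; from layer 3 every column leads to
  layer 2. The last entry of the first list and the first entry of the second are the boundary
  zeros.\<close>

lemma intersection_numbers_D:
  assumes reps: "\<And>g. g \<in> carrier_vec m \<Longrightarrow> g \<noteq> 0\<^sub>v m \<Longrightarrow> reps g = \<mu>"
  shows "intersection_numbers N D (\<lambda>l. [N, N - 1, N - \<mu>, 0] ! l) (\<lambda>l. [0, 1, \<mu>, N] ! l)"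
    (is "intersection_numbers N D ?b ?c")
  unfolding intersection_numbers_def covering_radius_D
proof (intro conjI allI ballI impI)
  fix l x
  assume l: "l \<le> 3" and xl: "x \<in> layer N D l"
  let ?s = "M *\<^sub>v x"
  have x: "x \<in> carrier_vec N" and lev: "level (par x) ?s = l"
    using xl by (auto simp: layer_def dist_code_D)
  have add_eq_0: "?s + t = 0\<^sub>v m \<longleftrightarrow> t = ?s" if "t \<in> T" for t
    using that T_carrier bit_vec_add_eq_0_iff[of ?s m t] by auto
  have p1: "par x + 1 = 0 \<longleftrightarrow> par x \<noteq> 0"
    by (simp add: bit_add_eq)
  note nb = card_neighbours[OF x]
  show "card {y \<in> layer N D (l - 1). hdist x y = 1} = ?c l" if pos: "0 < l"
  proof -
    consider "l = 1" | "l = 2" | "l = 3" using l pos by linarith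
    then show ?thesis
    proof cases
      case 1
      then have "{t \<in> T. level (par x + 1) (?s + t) = 0} = {?s}"
        using lev p1 add_eq_0 by (auto simp: level_eq_iff)
      then show ?thesis using 1 nb[of 0] by simp
    next
      case 2
      then have "{t \<in> T. level (par x + 1) (?s + t) = 1} = {t \<in> T. ?s + t \<in> T}"
        and "?s \<noteq> 0\<^sub>v m"
        using lev p1 by (auto simp: level_eq_iff)
      then show ?thesis using 2 reps[of ?s] nb[of 1] by (simp add: reps_def)
    next
      case 3
      then have "{t \<in> T. level (par x + 1) (?s + t) = 2} = T"
        using lev p1 add_eq_0 by (auto simp: level_eq_iff)
      then show ?thesis using 3 nb[of 2] by (simp add: card_T nth_Cons')
    qed
  qed
  show "card {y \<in> layer N D (l + 1). hdist x y = 1} = ?b l" if less: "l < 3"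
  proof -
    consider "l = 0" | "l = 1" | "l = 2" using less by linarith
    then show ?thesis
    proof cases
      case 1
      then have "{t \<in> T. level (par x + 1) (?s + t) = 1} = T"
        using lev p1 T_carrier by (auto simp: level_eq_iff)
      then show ?thesis using 1 nb[of 1] by (simp add: card_T)
    next
      case 2
      then have "{t \<in> T. level (par x + 1) (?s + t) = 2} = T - {?s}" "?s \<in> T"
        using lev p1 add_eq_0 by (auto simp: level_eq_iff)
      then show ?thesis using 2 nb[of 2] finite_T by (simp add: card_T numeral_2_eq_2)
    next
      case 3
      then have "{t \<in> T. level (par x + 1) (?s + t) = 3} = {t \<in> T. ?s + t \<notin> T}"
        and "?s \<noteq> 0\<^sub>v m"
        using lev p1 by (auto simp: level_eq_iff)
      then show ?thesis
        using 3 reps[of ?s] card_not_reps[of ?s] nb[of 3] by (simp add: nth_Cons')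
    qed
  qed
qed (simp_all add: nth_Cons')

lemma completely_regular_iff:
  "completely_regular N D \<longleftrightarrow> (\<exists>\<mu>. \<forall>g \<in> carrier_vec m - {0\<^sub>v m}. reps g = \<mu>)"
  unfolding completely_regular_def
  using reps_of_intersection_numbers intersection_numbers_D by (metis DiffE DiffI singletonI singletonD)

lemma has_intersection_array_D:
  assumes "\<And>g. g \<in> carrier_vec m \<Longrightarrow> g \<noteq> 0\<^sub>v m \<Longrightarrow> reps g = \<mu>"
  shows "has_intersection_array N D [N, N - 1, N - \<mu>] [1, \<mu>, N]"
  unfolding has_intersection_array_def covering_radius_D
proof (intro exI conjI)
  show "intersection_numbers N D (\<lambda>l. [N, N - 1, N - \<mu>, 0] ! l) (\<lambda>l. [0, 1, \<mu>, N] ! l)"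
    using intersection_numbers_D assms by blast
qed (simp_all add: upt_rec nth_Cons')

section \<open>Minimum distance and dimension\<close>

lemma minimum_distance_D:
  assumes ab: "a \<in> T" "b \<in> T" "a + b \<in> T" "a \<noteq> 0\<^sub>v m" "b \<noteq> 0\<^sub>v m" "a \<noteq> b"
  shows "minimum_distance D = 4"
proof -
  let ?S = "{hdist x y | x y. x \<in> D \<and> y \<in> D \<and> x \<noteq> y}"
  \<comment> \<open>Codewords have even parity, so their distances are even; distance 2 would force
    two equal columns of \<open>M\<close>.\<close>
  have lower: "4 \<le> hdist x y" if xy: "x \<in> D" "y \<in> D" "x \<noteq> y" for x y
  proof -
    have x: "x \<in> carrier_vec N" and y: "y \<in> carrier_vec N" using xy D_carrier by auto
    have "even (hdist x y)" using even_hdist_D[OF x xy(2)] xy(1) by (simp add: D)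
    moreover have "hdist x y \<noteq> 0" using xy(3) hdist_eq_0_iff[OF x y] by simp
    moreover have "hdist x y \<noteq> 2"
    proof
      assume "hdist x y = 2"
      then obtain i where i: "i < N" "hdist (x + unit_vec N i) y = 1"
        using hdist_SucE[OF x y, of 1] by (metis numeral_2_eq_2 One_nat_def)
      then obtain j where j: "j < N" "y = x + unit_vec N i + unit_vec N j"
        using hdist_eq_1_iff[of "x + unit_vec N i" N y] x y by auto
      have "M *\<^sub>v y = M *\<^sub>v x + col M i + col M j"
        using j x i by (simp add: syn_add_unit_vec del: assoc_add_vec)
      then have "col M i + col M j = 0\<^sub>v m"
        using xy by (simp add: D)
      then have "i = j"
        using inj_col i(1) j(1) by (auto simp: bit_vec_add_eq_0_iff[of _ m] dest: inj_onD)
      then have "y = x"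
        using j x by simp
      then show False using xy(3) by simp
    qed
    ultimately show ?thesis by presburger
  qed
  have carr: "a \<in> carrier_vec m" "b \<in> carrier_vec m" using ab T_carrier by auto
  have "\<exists>i<N. col M i = t" if "t \<in> T" for t
    using that by (auto simp: T_eq)
  from this[OF zero_T] this[OF ab(1)] this[OF ab(2)] this[OF ab(3)]
  obtain i0 ia ib iab where
    i: "i0 < N" "ia < N" "ib < N" "iab < N" "col M i0 = 0\<^sub>v m" "col M ia = a" "col M ib = b"
      "col M iab = a + b"
    by blast
  \<comment> \<open>The word of weight 4 is supported on the columns 0, \<open>a\<close>,
    \<open>b\<close> and \<open>a + b\<close>, whose sum vanishes; the zero column makes the number
    of flips even.\<close>
  define x1 :: "bit vec" where "x1 = 0\<^sub>v N + unit_vec N i0"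
  define x2 :: "bit vec" where "x2 = x1 + unit_vec N ia"
  define x3 :: "bit vec" where "x3 = x2 + unit_vec N ib"
  define x4 :: "bit vec" where "x4 = x3 + unit_vec N iab"
  have c: "x1 \<in> carrier_vec N" "x2 \<in> carrier_vec N" "x3 \<in> carrier_vec N" "x4 \<in> carrier_vec N"
    by (auto simp: x1_def x2_def x3_def x4_def)
  have "par x4 = 0"
    using i c by (simp add: x1_def x2_def x3_def x4_def sum_add_unit_vec bit_add_eq
        del: index_add_vec(1) left_zero_vec)
  moreover have "M *\<^sub>v x4 = 0\<^sub>v m"
  proof -
    have "M *\<^sub>v x4 = a + b + (a + b)"
      using i c M carr by (simp add: x4_def x3_def x2_def x1_def syn_add_unit_vec mat_mult_unit_vec
          del: index_add_vec(1))
    then show ?thesis using carr by simp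
  qed
  ultimately have x4: "x4 \<in> D" using c by (simp add: D)
  have "hdist (0\<^sub>v N) x4 \<le> 4"
    using hdist_triangle[of "0\<^sub>v N" N x1 x4] hdist_triangle[of x1 N x2 x4] hdist_triangle[of x2 N x3 x4]
      hdist_add_unit_vec[of "0\<^sub>v N" N i0] hdist_add_unit_vec[of x1 N ia]
      hdist_add_unit_vec[of x2 N ib] hdist_add_unit_vec[of x3 N iab] i c
    by (simp flip: x1_def x2_def x3_def x4_def del: left_zero_vec)
  \<comment> \<open>One nonzero entry is enough, since \<open>lower\<close> then turns the upper
    bound 4 into an equality. The column \<open>a + b\<close> differs from the other three, so its
    coordinate is flipped exactly once.\<close>
  moreover have "x4 \<noteq> 0\<^sub>v N"
  proof -
    have "a + b \<noteq> 0\<^sub>v m" "a + b \<noteq> a" "a + b \<noteq> b"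
      using ab(4-6) carr bit_vec_add_eq_0_iff[of a m b] bit_vec_add_eq_iff[of a m b a]
        bit_vec_add_eq_iff[of b m a b] comm_add_vec[of a m b] by auto
    then have "iab \<noteq> i0" "iab \<noteq> ia" "iab \<noteq> ib" using i by auto
    then have "x4 $ iab = 1"
      using i by (simp add: x4_def x3_def x2_def x1_def)
    then show ?thesis using i(4) by auto
  qed
  ultimately have "4 \<in> ?S"
    using lower[OF zero_in_D x4] zero_in_D x4 by (metis (mono_tags, lifting) mem_Collect_eq le_antisym)
  moreover have "finite ?S"
    by (rule finite_subset[of _ "{..N}"]) (use hdist_le D_carrier in auto)
  ultimately show ?thesis
    unfolding minimum_distance_def using lower by (intro Min_eqI) auto
qed

text \<open>Appending an all-ones row to \<open>M\<close> turns the parity condition into one more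
  check, so \<open>D\<close> is a kernel. By \<open>ex_par_syn\<close> every pair of syndrome and
  parity occurs, so the enlarged matrix is surjective.\<close>

lemma linear_code_D:
  "subspace class_ring D (module_vec TYPE(bit) N)"
  "vectorspace.dim class_ring ((module_vec TYPE(bit) N)\<lparr>carrier := D\<rparr>) = N - (m + 1)"
proof -
  define O1 :: "bit mat" where "O1 = mat 1 N (\<lambda>_. 1)"
  define E where "E = M @\<^sub>r O1"
  have O1: "O1 \<in> carrier_mat 1 N" by (simp add: O1_def)
  have E: "E \<in> carrier_mat (m + 1) N"
    using carrier_append_rows[OF M O1] by (simp add: E_def)
  have mult_O1: "O1 *\<^sub>v x = vec 1 (\<lambda>_. par x)" if "x \<in> carrier_vec N" for x
    using that by (intro eq_vecI) (auto simp: O1_def scalar_prod_def atLeast0LessThan)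
  have mult: "E *\<^sub>v x = M *\<^sub>v x @\<^sub>v vec 1 (\<lambda>_. par x)" if "x \<in> carrier_vec N" for x
    using that mat_mult_append[OF M O1 that] by (simp add: E_def mult_O1)
  have zero: "0\<^sub>v (m + 1) = 0\<^sub>v m @\<^sub>v (0\<^sub>v 1 :: bit vec)"
    by (intro eq_vecI) auto
  have vec1: "vec (Suc 0) (\<lambda>_. p) = 0\<^sub>v (Suc 0) \<longleftrightarrow> p = 0" for p :: bit
    by (auto simp: vec_eq_iff)
  have "mat_kernel E = D"
    unfolding mat_kernel[OF E] D zero
    by (auto simp: mult append_vec_eq[of _ m] vec1)
  moreover have "(*\<^sub>v) E ` carrier_vec N = carrier_vec (m + 1)"
  proof
    show "carrier_vec (m + 1) \<subseteq> (*\<^sub>v) E ` carrier_vec N"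
    proof
      fix y :: "bit vec" assume y: "y \<in> carrier_vec (m + 1)"
      obtain x where x: "x \<in> carrier_vec N" "par x = y $ m" "M *\<^sub>v x = vec m (\<lambda>i. y $ i)"
        using ex_par_syn[of "vec m (\<lambda>i. y $ i)" "y $ m"] by auto
      have "y = E *\<^sub>v x"
        using y x by (intro eq_vecI) (auto simp: mult less_Suc_eq)
      then show "y \<in> (*\<^sub>v) E ` carrier_vec N" using x(1) by auto
    qed
  qed (use E in auto)
  ultimately show "subspace class_ring D (module_vec TYPE(bit) N)"
    "vectorspace.dim class_ring ((module_vec TYPE(bit) N)\<lparr>carrier := D\<rparr>) = N - (m + 1)"
    using mat_kernel_subspace[OF E] by auto
qed

end

section \<open>Partial spreads of elementary abelian 2-groups\<close>

text \<open>Over the two-element field a set of vectors that contains 0 and is closed under addition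
  is a subspace, and size 2^k means dimension \<open>k\<close>.\<close>

locale partial_spread =
  fixes k t :: nat and W :: "nat \<Rightarrow> bit vec set"
  assumes W_carrier: "\<And>i. i < t \<Longrightarrow> W i \<subseteq> carrier_vec (2 * k)"
    and W_zero: "\<And>i. i < t \<Longrightarrow> 0\<^sub>v (2 * k) \<in> W i"
    and W_add: "\<And>i u v. i < t \<Longrightarrow> u \<in> W i \<Longrightarrow> v \<in> W i \<Longrightarrow> u + v \<in> W i"
    and W_card: "\<And>i. i < t \<Longrightarrow> card (W i) = 2 ^ k"
    and W_Int: "\<And>i j. i < t \<Longrightarrow> j < t \<Longrightarrow> i \<noteq> j \<Longrightarrow> W i \<inter> W j = {0\<^sub>v (2 * k)}"
begin

definition U :: "bit vec set" where
  "U = (\<Union>i<t. W i)"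

lemma W_subset_U: "i < t \<Longrightarrow> W i \<subseteq> U"
  by (auto simp: U_def)

lemma finite_W: "i < t \<Longrightarrow> finite (W i)"
  using W_carrier finite_subset finite_carrier_vec_bit by metis

lemma card_W_diff: "i < t \<Longrightarrow> card (W i - {0\<^sub>v (2 * k)}) = 2 ^ k - 1"
  by (simp add: W_zero W_card)

lemma card_U:
  assumes "0 < t"
  shows "card U = t * (2 ^ k - 1) + 1"
proof -
  let ?z = "0\<^sub>v (2 * k)"
  have U: "U = insert ?z (\<Union>i<t. W i - {?z})"
    using assms W_zero by (auto simp: U_def)
  have "card (\<Union>i<t. W i - {?z}) = (\<Sum>i<t. card (W i - {?z}))"
    using finite_W W_Int by (intro card_UN_disjoint) auto
  also have "\<dots> = t * (2 ^ k - 1)" by (simp add: card_W_diff)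
  finally show ?thesis
    unfolding U using finite_W by (subst card_insert_disjoint) auto
qed

text \<open>The trivial intersection makes addition injective on \<open>W i \<times> W j\<close>,
  and this product has as many elements as the ambient space, namely 2^(2k).\<close>

lemma ex_decomposition:
  assumes ij: "i < t" "j < t" "i \<noteq> j" and g: "g \<in> carrier_vec (2 * k)"
  shows "\<exists>u\<in>W i. \<exists>v\<in>W j. g = u + v"
proof -
  let ?f = "\<lambda>(u, v). u + v"
  have "inj_on ?f (W i \<times> W j)"
  proof (rule inj_onI, clarify)
    fix u v u' v' assume uv: "u \<in> W i" "v \<in> W j" "u' \<in> W i" "v' \<in> W j" "u + v = u' + v'"
    have c: "u \<in> carrier_vec (2 * k)" "v \<in> carrier_vec (2 * k)"
      "u' \<in> carrier_vec (2 * k)" "v' \<in> carrier_vec (2 * k)"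
      using uv W_carrier ij by auto
    have "u + u' = v + v'"
    proof -
      have "u' + (u + v) = v'"
        using uv(5) c by (simp add: bit_vec_add_self_left)
      then have "u' + u + v = v'" using c by (simp add: assoc_add_vec[of _ "2 * k"])
      then have "v + (u' + u) = v'" using c comm_add_vec[of v "2 * k" "u' + u"] by simp
      then have "u' + u = v + v'"
        using c by (subst (asm) bit_vec_add_eq_iff[of _ "2 * k"]) auto
      then show ?thesis using c comm_add_vec[of u "2 * k" u'] by simp
    qed
    moreover have "u + u' \<in> W i" "v + v' \<in> W j" using uv W_add ij by auto
    ultimately have "u + u' \<in> W i \<inter> W j" by simp
    then have "u + u' = 0\<^sub>v (2 * k)" "v + v' = 0\<^sub>v (2 * k)"
      using W_Int ij \<open>u + u' = v + v'\<close> by auto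
    then show "u = u' \<and> v = v'" using c by (simp add: bit_vec_add_eq_0_iff)
  qed
  then have "card (?f ` (W i \<times> W j)) = card (carrier_vec (2 * k) :: bit vec set)"
    using ij W_card by (simp add: card_image card_cartesian_product card_carrier_vec_bit mult_2 power_add)
  moreover have "?f ` (W i \<times> W j) \<subseteq> carrier_vec (2 * k)"
    using W_carrier[OF ij(1)] W_carrier[OF ij(2)] by (auto intro!: add_carrier_vec)
  ultimately have "?f ` (W i \<times> W j) = carrier_vec (2 * k)"
    by (intro card_subset_eq) auto
  then have "g \<in> ?f ` (W i \<times> W j)" using g by simp
  then show ?thesis by auto
qed

text \<open>Existence is the decomposition; two solutions differ by an element of
  \<open>W i \<inter> W j\<close>, which is 0.\<close>

lemma card_representations:
  assumes ij: "i < t" "j < t" "i \<noteq> j" and g: "g \<in> carrier_vec (2 * k)"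
  shows "card {s \<in> W i. g + s \<in> W j} = 1"
proof -
  obtain u v where uv: "u \<in> W i" "v \<in> W j" "g = u + v"
    using ex_decomposition[OF assms] by auto
  have c: "u \<in> carrier_vec (2 * k)" "v \<in> carrier_vec (2 * k)" using uv W_carrier ij by auto
  have "s = u" if s: "s \<in> W i" "g + s \<in> W j" for s
  proof -
    have sc: "s \<in> carrier_vec (2 * k)" using s W_carrier ij by auto
    have "v + (g + s) = u + s"
    proof -
      have "g = v + u" using uv(3) c comm_add_vec by blast
      then have "v + g = u" using c by (simp add: bit_vec_add_self_left)
      then show ?thesis using c g sc by (simp flip: assoc_add_vec[of v "2 * k" g s])
    qed
    moreover have "u + s \<in> W i" "v + (g + s) \<in> W j" using uv s W_add ij by auto
    ultimately have "u + s \<in> W i \<inter> W j" by simp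
    then show ?thesis using W_Int ij c sc by (auto simp: bit_vec_add_eq_0_iff[of u "2 * k" s])
  qed
  moreover have "g + u \<in> W j"
  proof -
    have "g + u = v" using uv(3) c comm_add_vec[of "u + v" "2 * k" u] by (simp add: bit_vec_add_self_left)
    then show ?thesis using uv by simp
  qed
  ultimately have "{s \<in> W i. g + s \<in> W j} = {u}" using uv by auto
  then show ?thesis by simp
qed

lemma sum_in_W_iff:
  assumes i: "i < t" and s: "s \<in> W i" and g: "g \<in> carrier_vec (2 * k)"
  shows "g + s \<in> W i \<longleftrightarrow> g \<in> W i"
proof
  assume "g + s \<in> W i"
  then have "s + (g + s) \<in> W i" using i s W_add by blast
  moreover have "s + (g + s) = g"
    using g s W_carrier[OF i] comm_add_vec[of g "2 * k" s] by (auto simp: bit_vec_add_self_left)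
  ultimately show "g \<in> W i" by simp
qed (use assms W_add in auto)

text \<open>Each pair contributes one \<open>s\<close>. An \<open>s\<close> shared by two pairs
  would satisfy s = 0 or g + s = 0 by the trivial intersections, placing \<open>g\<close> in a
  subspace that \<open>P\<close> excludes. The index set stays general because both counts below use
  it.\<close>

lemma card_UN_representations:
  assumes P: "P \<subseteq> {(i, j). i < t \<and> j < t \<and> i \<noteq> j \<and> g \<notin> W i \<and> g \<notin> W j}"
    and g: "g \<in> carrier_vec (2 * k)"
  shows "card (\<Union>(i, j)\<in>P. {s \<in> W i. g + s \<in> W j}) = card P"
proof -
  have fin: "finite P"
    by (rule finite_subset[of _ "{..<t} \<times> {..<t}"]) (use P in auto)
  let ?R = "\<lambda>p. case p of (i, j) \<Rightarrow> {s \<in> W i. g + s \<in> W j}"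
  have disjoint: "?R (i, j) \<inter> ?R (i', j') = {}"
    if p: "(i, j) \<in> P" "(i', j') \<in> P" and ne: "(i, j) \<noteq> (i', j')" for i j i' j'
  proof (rule ccontr)
    assume "?R (i, j) \<inter> ?R (i', j') \<noteq> {}"
    then obtain s where s: "s \<in> W i" "g + s \<in> W j" "s \<in> W i'" "g + s \<in> W j'" by auto
    show False
    proof (cases "i = i'")
      case True
      then have "g + s \<in> W j \<inter> W j'" "j \<noteq> j'" using ne s by auto
      then have "g + s = 0\<^sub>v (2 * k)" using p P W_Int[of j j'] by auto
      moreover have "s \<in> carrier_vec (2 * k)" using s p P W_carrier by auto
      ultimately have "g = s" using g bit_vec_add_eq_0_iff by blast
      then show False using s p P by auto
    next
      case False
      then have "s = 0\<^sub>v (2 * k)" using s p P W_Int[of i i'] by auto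
      then have "g \<in> W j" using s g by simp
      then show False using p P by auto
    qed
  qed
  have "card (\<Union>p\<in>P. ?R p) = (\<Sum>p\<in>P. card (?R p))"
  proof (rule card_UN_disjoint[OF fin])
    show "\<forall>p\<in>P. finite (?R p)" using P finite_W by auto
    show "\<forall>p\<in>P. \<forall>p'\<in>P. p \<noteq> p' \<longrightarrow> ?R p \<inter> ?R p' = {}"
    proof (intro ballI impI)
      fix p p' assume "p \<in> P" "p' \<in> P" "p \<noteq> p'"
      then show "?R p \<inter> ?R p' = {}"
        using disjoint[of "fst p" "snd p" "fst p'" "snd p'"] by (simp add: case_prod_beta prod_eq_iff)
    qed
  qed
  also have "\<dots> = (\<Sum>p\<in>P. 1)"
    using P card_representations[OF _ _ _ g] by (intro sum.cong) auto
  finally show ?thesis by simp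
qed

lemma card_off_diagonal: "finite I \<Longrightarrow> card {(i, j). i \<in> I \<and> j \<in> I \<and> i \<noteq> j} = card I * (card I - 1)"
proof -
  assume I: "finite I"
  have "{(i, j). i \<in> I \<and> j \<in> I \<and> i \<noteq> j} = (SIGMA i:I. I - {i})" by auto
  then show ?thesis using I by simp
qed

text \<open>If \<open>s\<close> and \<open>g + s\<close> lay in the same subspace, so would
  \<open>g\<close>. Hence every ordered pair of distinct indices counts, once each.\<close>

lemma card_differences_outside:
  assumes g: "g \<in> carrier_vec (2 * k)" "g \<notin> U"
  shows "card {s \<in> U. g + s \<in> U} = t * (t - 1)"
proof -
  let ?P = "{(i, j). i \<in> {..<t} \<and> j \<in> {..<t} \<and> i \<noteq> j}"
  have "{s \<in> U. g + s \<in> U} = (\<Union>(i, j)\<in>?P. {s \<in> W i. g + s \<in> W j})"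
    using g sum_in_W_iff[OF _ _ g(1)] by (auto simp: U_def)
  moreover have "?P \<subseteq> {(i, j). i < t \<and> j < t \<and> i \<noteq> j \<and> g \<notin> W i \<and> g \<notin> W j}"
    using g(2) by (auto simp: U_def)
  ultimately show ?thesis
    using card_UN_representations[of ?P g] g(1) card_off_diagonal[of "{..<t}"] by simp
qed

text \<open>The vector \<open>g\<close> lies in exactly one subspace \<open>W l\<close>, all of
  whose 2^k elements qualify. Any other \<open>s\<close> that qualifies has \<open>s\<close> and
  \<open>g + s\<close> in two distinct ones of the remaining t - 1 subspaces.\<close>

lemma card_differences_inside:
  assumes g: "g \<in> U" "g \<noteq> 0\<^sub>v (2 * k)"
  shows "card {s \<in> U. g + s \<in> U} = 2 ^ k + (t - 1) * (t - 2)"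
proof -
  obtain l where l: "l < t" "g \<in> W l" using g(1) by (auto simp: U_def)
  have gc: "g \<in> carrier_vec (2 * k)" using l W_carrier by auto
  have other: "g \<notin> W i" if "i < t" "i \<noteq> l" for i
    using W_Int[of i l] that l g(2) by auto
  let ?I = "{..<t} - {l}"
  let ?P = "{(i, j). i \<in> ?I \<and> j \<in> ?I \<and> i \<noteq> j}"
  let ?R = "\<Union>(i, j)\<in>?P. {s \<in> W i. g + s \<in> W j}"
  have in_l: "s \<in> W l" if "s \<in> carrier_vec (2 * k)" "g + s \<in> W l" for s
  proof -
    have "g + (g + s) \<in> W l" using l that W_add by blast
    then show ?thesis using that gc by (simp add: bit_vec_add_self_left)
  qed
  have eq: "{s \<in> U. g + s \<in> U} = W l \<union> ?R"
  proof (rule Set.set_eqI, rule iffI)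
    fix s assume s: "s \<in> {s \<in> U. g + s \<in> U}"
    then obtain i j where ij: "i < t" "j < t" "s \<in> W i" "g + s \<in> W j" by (auto simp: U_def)
    have sc: "s \<in> carrier_vec (2 * k)" using ij W_carrier by auto
    show "s \<in> W l \<union> ?R"
    proof (cases "s \<in> W l")
      case False
      then have "i \<noteq> l" "j \<noteq> l" using ij in_l[OF sc] by auto
      moreover have "i \<noteq> j" using ij sum_in_W_iff[of i s g] gc other[of i] \<open>i \<noteq> l\<close> by auto
      ultimately show ?thesis using ij by auto
    qed simp
  next
    fix s assume "s \<in> W l \<union> ?R"
    then show "s \<in> {s \<in> U. g + s \<in> U}"
      using l W_add[of l g s] by (auto simp: U_def)
  qed
  have False if sl: "s \<in> W l" and sR: "s \<in> ?R" for s
  proof -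
    obtain i j where ij: "s \<in> W i" "g + s \<in> W j" "i < t" "i \<noteq> l" "j < t" "j \<noteq> l"
      using sR by auto
    then have "s = 0\<^sub>v (2 * k)" using W_Int[of i l] l sl by auto
    then show False using ij gc other[of j] by simp
  qed
  then have disj: "W l \<inter> ?R = {}" by blast
  have "card ?R = card ?P"
    using other gc by (intro card_UN_representations) auto
  also have "\<dots> = (t - 1) * (t - 2)"
    using card_off_diagonal[of ?I] l(1) by (simp add: numeral_2_eq_2)
  finally have "card ?R = (t - 1) * (t - 2)" .
  moreover have "finite ?R"
    by (rule finite_subset[of _ "carrier_vec (2 * k)"]) (use W_carrier in auto)
  ultimately show ?thesis
    unfolding eq using card_Un_disjoint[of "W l" ?R] disj finite_W l(1) W_card by simp
qed

end

section \<open>Matrices with equal kernels\<close>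

text \<open>Sums of at most three unit vectors in the kernel reveal which columns vanish, which
  coincide and which are sums of two others. This lemma and the next two let such facts pass between
  matrices with the same kernel.\<close>

lemma unit_vec_in_kernel:
  assumes "A \<in> carrier_mat m n" "i < n"
  shows "unit_vec n i \<in> mat_kernel A \<longleftrightarrow> col A i = (0\<^sub>v m :: bit vec)"
  by (simp add: mat_kernel[OF assms(1)] mat_mult_unit_vec[OF assms])

lemma two_unit_vecs_in_kernel:
  assumes "A \<in> carrier_mat m n" "i < n" "j < n"
  shows "unit_vec n i + unit_vec n j \<in> mat_kernel A \<longleftrightarrow> col A i = (col A j :: bit vec)"
proof -
  have "col A i \<in> carrier_vec m" for i using assms(1) col_dim[of A i] by simp
  then show ?thesis
    using bit_vec_add_eq_0_iff[of "col A i" m "col A j"] assms(2,3)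
    by (simp add: mat_kernel[OF assms(1)] mat_mult_unit_vec[OF assms(1)]
        mult_add_distrib_mat_vec[OF assms(1)])
qed

lemma three_unit_vecs_in_kernel:
  assumes "A \<in> carrier_mat m n" "i < n" "j < n" "l < n"
  shows "unit_vec n i + unit_vec n j + unit_vec n l \<in> mat_kernel A
    \<longleftrightarrow> col A i + col A j = (col A l :: bit vec)"
proof -
  have "col A i \<in> carrier_vec m" for i using assms(1) col_dim[of A i] by simp
  then show ?thesis
    using bit_vec_add_eq_0_iff[of "col A i + col A j" m "col A l"] assms(2-4)
    by (simp add: mat_kernel[OF assms(1)] mat_mult_unit_vec[OF assms(1)]
        mult_add_distrib_mat_vec[OF assms(1)] del: assoc_add_vec)
qed

lemma distinct_cols_iff:
  "distinct (cols A) \<longleftrightarrow> inj_on (col A) {..<dim_col A}"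
  by (simp add: cols_def distinct_map atLeast0LessThan)

lemma set_cols: "set (cols A) = col A ` {..<dim_col A}"
  by (simp add: cols_def atLeast0LessThan)

text \<open>The definition of a Hamming code only supplies some \<open>P\<close> with the same
  kernel as \<open>H\<close>. Being nonzero and distinct transfers to the columns of
  \<open>H\<close> through the kernel, and 2^k - 1 of them exhaust the nonzero vectors.\<close>

lemma hamming_code_columns:
  assumes H: "H \<in> carrier_mat k (2 ^ k - 1)" and ham: "hamming_code k (mat_kernel H)"
  shows "distinct (cols H)" "set (cols H) = carrier_vec k - {0\<^sub>v k}"
proof -
  let ?n = "2 ^ k - 1 :: nat"
  obtain P where P: "P \<in> carrier_mat k ?n" "distinct (cols P)"
      "set (cols P) = carrier_vec k - {0\<^sub>v k}" "mat_kernel H = mat_kernel P"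
    using ham by (auto simp: hamming_code_def)
  have "inj_on (col P) {..<?n}"
    using P(1,2) by (simp add: distinct_cols_iff)
  then have "inj_on (col H) {..<?n}"
    using two_unit_vecs_in_kernel[OF H] two_unit_vecs_in_kernel[OF P(1)] P(4)
    by (auto simp: inj_on_def)
  then show d: "distinct (cols H)" using H by (simp add: distinct_cols_iff)
  have "col P i \<noteq> 0\<^sub>v k" if "i < ?n" for i
    using P(1,3) that by (auto simp: set_cols)
  then have "col H i \<noteq> 0\<^sub>v k" if "i < ?n" for i
    using unit_vec_in_kernel[OF H] unit_vec_in_kernel[OF P(1)] P(4) that by auto
  then have sub: "set (cols H) \<subseteq> carrier_vec k - {0\<^sub>v k}"
    using H by (auto simp: set_cols)
  show "set (cols H) = carrier_vec k - {0\<^sub>v k}"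
    using distinct_card[OF d] H
    by (intro card_subset_eq[OF _ sub]) (simp_all add: card_carrier_vec_bit)
qed

text \<open>The columns of \<open>H\<close> together with 0 are closed under addition, and each
  relation among three columns is visible in the kernel, so \<open>F\<close> inherits the closure
  although its columns may live in a larger space.\<close>

lemma same_kernel_subspace:
  fixes H F :: "bit mat"
  assumes H: "H \<in> carrier_mat k n" "n = 2 ^ k - 1" "distinct (cols H)"
      "set (cols H) = carrier_vec k - {0\<^sub>v k}"
    and F: "F \<in> carrier_mat m n" and ker: "mat_kernel F = mat_kernel H"
  shows "distinct (cols F)" "0\<^sub>v m \<notin> set (cols F)" "card (insert (0\<^sub>v m) (set (cols F))) = 2 ^ k"
    "\<And>u v. u \<in> insert (0\<^sub>v m) (set (cols F)) \<Longrightarrow> v \<in> insert (0\<^sub>v m) (set (cols F)) \<Longrightarrow>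
      u + v \<in> insert (0\<^sub>v m) (set (cols F))"
proof -
  have cH: "set (cols H) = col H ` {..<n}" and cF: "set (cols F) = col F ` {..<n}"
    using H F by (simp_all add: set_cols)
  have inj: "inj_on (col H) {..<n}" using H by (simp add: distinct_cols_iff)
  then have "inj_on (col F) {..<n}"
    using two_unit_vecs_in_kernel[OF H(1)] two_unit_vecs_in_kernel[OF F] ker
    by (auto simp: inj_on_def)
  then show d: "distinct (cols F)" using F by (simp add: distinct_cols_iff)
  have "col H i \<noteq> 0\<^sub>v k" if "i < n" for i
    using H(4) that by (auto simp: cH)
  then have "col F i \<noteq> 0\<^sub>v m" if "i < n" for i
    using unit_vec_in_kernel[OF H(1) that] unit_vec_in_kernel[OF F that] ker that by auto
  then show nz: "0\<^sub>v m \<notin> set (cols F)"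
    unfolding cF by (metis imageE lessThan_iff)
  show "card (insert (0\<^sub>v m) (set (cols F))) = 2 ^ k"
    using nz distinct_card[OF d] F H(2) by simp
  have carr: "set (cols F) \<subseteq> carrier_vec m" using F cols_dim[of F] by simp
  fix u v assume uv: "u \<in> insert (0\<^sub>v m) (set (cols F))" "v \<in> insert (0\<^sub>v m) (set (cols F))"
  consider "u = 0\<^sub>v m" | "v = 0\<^sub>v m" | "u = v" | "u \<in> set (cols F)" "v \<in> set (cols F)" "u \<noteq> v"
    using uv by auto
  then show "u + v \<in> insert (0\<^sub>v m) (set (cols F))"
  proof cases
    case 4
    then obtain i j where ij: "i < n" "j < n" "u = col F i" "v = col F j" "i \<noteq> j"
      by (auto simp: cF)
    then have "col H i \<noteq> col H j" using inj by (auto dest: inj_onD)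
    moreover have ci: "col H i \<in> carrier_vec k" for i
      using H(1) col_dim[of H i] by simp
    ultimately have "col H i + col H j \<in> carrier_vec k - {0\<^sub>v k}"
      using bit_vec_add_eq_0_iff[OF ci ci] by simp
    then have "col H i + col H j \<in> set (cols H)"
      by (simp only: H(4))
    then obtain l where l: "l < n" "col H i + col H j = col H l" by (auto simp: cH)
    then have "col F i + col F j = col F l"
      using three_unit_vecs_in_kernel[OF H(1) ij(1,2) l(1)]
        three_unit_vecs_in_kernel[OF F ij(1,2) l(1)] ker by simp
    then show ?thesis using ij l(1) by (auto simp: cF)
  qed (use uv carr in auto)
qed

section \<open>Cyclic shifts\<close>

text \<open>The source index used by both \<open>shift_cols\<close> and \<open>cyclic_shift\<close>,
  named so that sums can be reindexed along it.\<close>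

definition pred_mod :: "nat \<Rightarrow> nat \<Rightarrow> nat" where
  "pred_mod n j = (if j = 0 then n - 1 else j - 1)"

lemma bij_betw_pred_mod: "bij_betw (pred_mod n) {..<n} {..<n}"
  by (rule bij_betw_byWitness[where f' = "\<lambda>j. if j = n - 1 then 0 else Suc j"])
    (auto simp: pred_mod_def)

lemma shift_cols_carrier [simp]: "A \<in> carrier_mat m n \<Longrightarrow> shift_cols A \<in> carrier_mat m n"
  by (intro carrier_matI) (simp_all add: shift_cols_def)

lemma shift_cols_funpow_carrier [simp]:
  "A \<in> carrier_mat m n \<Longrightarrow> (shift_cols ^^ i) A \<in> carrier_mat m n"
  by (induction i) simp_all

text \<open>Both operations apply the same permutation of indices, so the terms of the product are
  only reordered.\<close>

lemma shift_cols_mult_cyclic_shift: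
  fixes A :: "'a :: comm_ring_1 mat"
  assumes "A \<in> carrier_mat m n" "x \<in> carrier_vec n"
  shows "shift_cols A *\<^sub>v cyclic_shift x = A *\<^sub>v x"
proof (rule eq_vecI)
  fix r assume r: "r < dim_vec (A *\<^sub>v x)"
  have "(shift_cols A *\<^sub>v cyclic_shift x) $ r = (\<Sum>j<n. A $$ (r, pred_mod n j) * x $ pred_mod n j)"
    using assms r by (auto simp: shift_cols_def cyclic_shift_def scalar_prod_def pred_mod_def
        atLeast0LessThan intro!: sum.cong)
  also have "\<dots> = (\<Sum>j<n. A $$ (r, j) * x $ j)"
    by (rule sum.reindex_bij_betw[OF bij_betw_pred_mod])
  also have "\<dots> = (A *\<^sub>v x) $ r"
    using assms r by (auto simp: scalar_prod_def atLeast0LessThan intro!: sum.cong)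
  finally show "(shift_cols A *\<^sub>v cyclic_shift x) $ r = (A *\<^sub>v x) $ r" .
qed (use assms in \<open>simp add: shift_cols_def\<close>)

lemma cyclic_shift_surj: "cyclic_shift ` carrier_vec n = carrier_vec n"
proof (safe)
  fix y :: "'a vec" assume y: "y \<in> carrier_vec n"
  let ?x = "vec n (\<lambda>j. y $ (if j = n - 1 then 0 else Suc j))"
  have "cyclic_shift ?x = y"
    using y by (intro eq_vecI) (auto simp: cyclic_shift_def)
  then show "y \<in> cyclic_shift ` carrier_vec n" by (intro image_eqI[of _ _ ?x]) auto
qed (auto simp: cyclic_shift_def)

lemma mat_kernel_shift_cols:
  fixes A :: "'a :: comm_ring_1 mat"
  assumes A: "A \<in> carrier_mat m n"
  shows "mat_kernel (shift_cols A) = cyclic_shift ` mat_kernel A"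
proof -
  have "y \<in> mat_kernel (shift_cols A) \<longleftrightarrow> y \<in> cyclic_shift ` mat_kernel A" for y
  proof
    assume y: "y \<in> mat_kernel (shift_cols A)"
    then have "y \<in> carrier_vec n" using A mat_kernelD(1) shift_cols_carrier by blast
    then obtain x where x: "x \<in> carrier_vec n" "y = cyclic_shift x"
      using cyclic_shift_surj[of n] by blast
    then have "x \<in> mat_kernel A"
      using y A shift_cols_mult_cyclic_shift[OF A] by (simp add: mat_kernel[of _ m n])
    then show "y \<in> cyclic_shift ` mat_kernel A" using x by blast
  next
    assume "y \<in> cyclic_shift ` mat_kernel A"
    then obtain x where x: "x \<in> mat_kernel A" "y = cyclic_shift x" by blast
    then have xc: "x \<in> carrier_vec n" using A mat_kernelD(1) by blast
    then have "y \<in> carrier_vec n" using x(2) cyclic_shift_surj[of n] by blast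
    then show "y \<in> mat_kernel (shift_cols A)"
      using x A xc shift_cols_mult_cyclic_shift[OF A xc] by (simp add: mat_kernel[of _ m n])
  qed
  then show ?thesis by blast
qed

text \<open>Cyclicity enters here: one shift of the columns moves the kernel by
  \<open>cyclic_shift\<close>, which maps it onto itself.\<close>

lemma mat_kernel_shift_cols_funpow:
  fixes A :: "bit mat"
  assumes "A \<in> carrier_mat m n" "cyclic_code (mat_kernel A)"
  shows "mat_kernel ((shift_cols ^^ i) A) = mat_kernel A"
proof (induction i)
  case (Suc i)
  have "mat_kernel (shift_cols ((shift_cols ^^ i) A)) = cyclic_shift ` mat_kernel ((shift_cols ^^ i) A)"
    by (rule mat_kernel_shift_cols) (rule shift_cols_funpow_carrier[OF assms(1)])
  also have "\<dots> = mat_kernel A"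
    using assms(2) unfolding Suc cyclic_code_def .
  finally show ?case by simp
qed simp

lemma col_shift_cols:
  assumes "A \<in> carrier_mat m n" "j < n"
  shows "col (shift_cols A) j = col A (pred_mod n j)"
  using assms by (intro eq_vecI) (auto simp: shift_cols_def pred_mod_def)

text \<open>Adding \<open>n\<close> before subtracting \<open>i\<close> keeps the subtraction on
  naturals from truncating.\<close>

lemma col_shift_cols_funpow:
  assumes A: "A \<in> carrier_mat m n" and "i < n" "j < n"
  shows "col ((shift_cols ^^ i) A) j = col A ((j + n - i) mod n)"
  using assms(2,3)
proof (induction i arbitrary: j)
  case (Suc i)
  have "pred_mod n j < n" using Suc.prems by (auto simp: pred_mod_def)
  moreover have "(pred_mod n j + n - i) mod n = (j + n - Suc i) mod n"
  proof (cases "j = 0")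
    case True
    then have "pred_mod n j + n - i = (n - Suc i) + n" using Suc.prems by (auto simp: pred_mod_def)
    then show ?thesis using True by simp
  qed (use Suc.prems in \<open>simp add: pred_mod_def\<close>)
  ultimately show ?case
    using Suc col_shift_cols[of "(shift_cols ^^ i) A" m n j] A by simp
qed simp

text \<open>The source positions differ by j - i modulo \<open>n\<close>, and 0 < j - i < n.\<close>

lemma col_shift_cols_funpow_neq:
  assumes A: "A \<in> carrier_mat m n" "distinct (cols A)" and ij: "i < j" "j < n" "l < n"
  shows "col ((shift_cols ^^ i) A) l \<noteq> col ((shift_cols ^^ j) A) l"
proof
  assume "col ((shift_cols ^^ i) A) l = col ((shift_cols ^^ j) A) l"
  then have "col A ((l + n - i) mod n) = col A ((l + n - j) mod n)"
    using A ij by (simp add: col_shift_cols_funpow)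
  moreover have "inj_on (col A) {..<n}" using A by (simp add: distinct_cols_iff)
  ultimately have "(l + n - i) mod n = (l + n - j) mod n"
    using ij by (auto dest!: inj_onD)
  then have "n dvd (l + n - i) - (l + n - j)"
    using ij by (subst (asm) mod_eq_dvd_iff_nat) auto
  then have "n dvd j - i" using ij by simp
  then show False using ij by (auto dest!: dvd_imp_le)
qed

section \<open>The block matrix\<close>

lemma col_append_rows:
  assumes "A \<in> carrier_mat m n" "B \<in> carrier_mat m' n" "j < n"
  shows "col (A @\<^sub>r B) j = col A j @\<^sub>v col B j"
  using assms by (intro eq_vecI) (auto simp: append_rows_def)

lemma mat_kernel_append_rows:
  assumes A: "A \<in> carrier_mat m n" and B: "B \<in> carrier_mat m' n"
  shows "mat_kernel (A @\<^sub>r B) = mat_kernel A \<inter> mat_kernel (B :: 'a :: comm_ring_1 mat)"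
proof -
  have "0\<^sub>v (m + m') = 0\<^sub>v m @\<^sub>v (0\<^sub>v m' :: 'a vec)" by (intro eq_vecI) auto
  then show ?thesis
    using A B by (auto simp: mat_kernel[OF carrier_append_rows[OF A B]] mat_kernel[OF A]
        mat_kernel[OF B] mat_mult_append[OF A B] append_vec_eq[of _ m])
qed

text \<open>A uniform numbering of the block columns: from s = 2 on the shift count is s - 2, so the
  unshifted pair is s = 2.\<close>

definition spread_block :: "bit mat \<Rightarrow> nat \<Rightarrow> bit mat" where
  "spread_block H s =
     (let Z = 0\<^sub>m (dim_row H) (dim_col H) in
      if s = 0 then H @\<^sub>r Z else if s = 1 then Z @\<^sub>r H else H @\<^sub>r (shift_cols ^^ (s - 2)) H)"

lemma block_parity_check_eq:
  "block_parity_check H c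
    = mat_of_cols (2 * dim_row H) (concat (map (\<lambda>s. cols (spread_block H s)) [0..<c + 3]))"
proof -
  let ?Z = "0\<^sub>m (dim_row H) (dim_col H)"
  have "[H @\<^sub>r ?Z, ?Z @\<^sub>r H, H @\<^sub>r H] @ map (\<lambda>i. H @\<^sub>r (shift_cols ^^ i) H) [1..<c + 1]
      = map (spread_block H) [0..<c + 3]" (is "?l = ?r")
  proof (rule nth_equalityI)
    fix i assume "i < length ?l"
    then have i: "i < c + 3" by (simp del: upt_Suc)
    \<comment> \<open>Position j + 3 carries the shift j + 1, because the list of shifts starts at
      1.\<close>
    consider "i = 0" | "i = 1" | "i = 2" | j where "i = Suc (Suc (Suc j))"
      by (metis One_nat_def Suc_1 not0_implies_Suc)
    then show "?l ! i = ?r ! i"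
      using i by cases (simp_all add: spread_block_def Let_def del: upt_Suc)
  qed (simp del: upt_Suc)
  then show ?thesis
    unfolding block_parity_check_def Let_def by (simp only: map_map o_def)
qed

section \<open>The partial spread of a cyclic Hamming code\<close>

locale cyclic_hamming =
  fixes k n c :: nat and H :: "bit mat"
  assumes n: "n = 2 ^ k - 1" and H: "H \<in> carrier_mat k n"
    and distinct_H: "distinct (cols H)" and cols_H: "set (cols H) = carrier_vec k - {0\<^sub>v k}"
    and cyclic: "cyclic_code (mat_kernel H)"
    and c: "1 \<le> c" "c + 2 \<le> n"
begin

abbreviation F :: "nat \<Rightarrow> bit mat" where
  "F \<equiv> spread_block H"

lemma F_carrier: "F s \<in> carrier_mat (2 * k) n"
  unfolding spread_block_def Let_def carrier_matD[OF H] mult_2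
  by (auto intro!: carrier_append_rows H shift_cols_funpow_carrier)

lemma cols_F_carrier: "set (cols (F s)) \<subseteq> carrier_vec (2 * k)"
  using F_carrier[of s] cols_dim[of "F s"] by simp

text \<open>Stacking matrices intersects their kernels. The zero block has the full space as its
  kernel, and a shifted block has the kernel of \<open>H\<close> again.\<close>

lemma kernel_F: "mat_kernel (F s) = mat_kernel H"
proof -
  have "mat_kernel (0\<^sub>m k n :: bit mat) = carrier_vec n"
    by (auto simp: mat_kernel_def)
  moreover have "mat_kernel H \<subseteq> carrier_vec n" using H by (rule mat_kernel_carrier)
  ultimately show ?thesis
    using H mat_kernel_shift_cols_funpow[OF H cyclic]
    by (auto simp: spread_block_def Let_def mat_kernel_append_rows[of _ k n _ k])
qed

lemma col_F:
  assumes "j < n"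
  shows "col (F s) j = (if s = 0 then col H j @\<^sub>v 0\<^sub>v k else if s = 1 then 0\<^sub>v k @\<^sub>v col H j
    else col H j @\<^sub>v col ((shift_cols ^^ (s - 2)) H) j)"
  using assms H by (auto simp: spread_block_def Let_def col_append_rows[of _ k n _ k])

lemmas F_same_kernel = same_kernel_subspace[OF H n distinct_H cols_H F_carrier kernel_F]

text \<open>Block 0 has lower half 0, block 1 has upper half 0, and in all other blocks both halves
  are nonzero. Between two of those others, equal upper halves fix the column position, where the
  lower halves differ.\<close>

lemma cols_F_disjoint:
  assumes s: "s < s'" "s' < c + 3"
  shows "set (cols (F s)) \<inter> set (cols (F s')) = {}"
proof -
  have nz: "col ((shift_cols ^^ i) H) j \<noteq> 0\<^sub>v k" if "j < n" for i j
    using same_kernel_subspace(2)[OF H n distinct_H cols_H _ mat_kernel_shift_cols_funpow[OF H cyclic]] H that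
    by (metis carrier_matD(2) image_eqI lessThan_iff set_cols shift_cols_funpow_carrier)
  have nz': "col H j \<noteq> 0\<^sub>v k" if "j < n" for j using nz[of j 0] that by simp
  have carr: "col H j \<in> carrier_vec k" "col ((shift_cols ^^ i) H) j \<in> carrier_vec k" for i j
    using H shift_cols_funpow_carrier[OF H, of i] by (metis carrier_matD(1) col_dim)+
  have "col (F s) a \<noteq> col (F s') b" if ab: "a < n" "b < n" for a b
  proof
    assume eq: "col (F s) a = col (F s') b"
    consider "s = 0" "s' = 1" | "s = 0" "s' \<ge> 2" | "s = 1" "s' \<ge> 2" | "s \<ge> 2" "s' \<ge> 2"
      using s by linarith
    then show False
    proof cases
      case 1
      then show False using eq ab carr nz' by (simp add: col_F append_vec_eq[of _ k])
    next
      case 2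
      then show False using eq ab carr nz[of b "s' - 2"] by (simp add: col_F append_vec_eq[of _ k])
    next
      case 3
      then show False using eq ab carr nz'[of b] by (simp add: col_F append_vec_eq[of _ k])
    next
      \<comment> \<open>Here s' - 2 \<le> c < n, so the two shift counts are distinct modulo
        \<open>n\<close>.\<close>
      case 4
      then have e: "col H a = col H b"
          "col ((shift_cols ^^ (s - 2)) H) a = col ((shift_cols ^^ (s' - 2)) H) b"
        using eq ab carr by (simp_all add: col_F append_vec_eq[of _ k])
      have "inj_on (col H) {..<n}" using distinct_H H by (simp add: distinct_cols_iff)
      then have "a = b" using e(1) ab by (auto dest: inj_onD)
      then show False
        using e(2) col_shift_cols_funpow_neq[OF H distinct_H, of "s - 2" "s' - 2" b] 4 s ab c by auto
    qed
  qed
  then show ?thesis unfolding set_cols carrier_matD(2)[OF F_carrier] by blast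
qed

sublocale partial_spread k "c + 3" "\<lambda>s. insert (0\<^sub>v (2 * k)) (set (cols (F s)))"
proof
  fix i j :: nat assume "i < c + 3" "j < c + 3" "i \<noteq> j"
  then have "set (cols (F i)) \<inter> set (cols (F j)) = {}"
    using cols_F_disjoint[of i j] cols_F_disjoint[of j i] by (metis Int_commute nat_neq_iff)
  then show "insert (0\<^sub>v (2 * k)) (set (cols (F i))) \<inter> insert (0\<^sub>v (2 * k)) (set (cols (F j)))
      = {0\<^sub>v (2 * k)}" by auto
qed (use F_same_kernel(3,4) cols_F_carrier in auto)

abbreviation P :: "bit mat" where
  "P \<equiv> block_parity_check H c"

lemma cols_P: "cols P = concat (map (\<lambda>s. cols (F s)) [0..<c + 3])"
proof -
  have "set (concat (map (\<lambda>s. cols (F s)) [0..<c + 3])) \<subseteq> carrier_vec (2 * k)"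
    using cols_F_carrier by auto
  then show ?thesis using H by (simp only: block_parity_check_eq) simp
qed

lemma U_eq: "U = insert (0\<^sub>v (2 * k)) (set (cols P))"
  by (auto simp: U_def cols_P lessThan_empty_iff)

lemma distinct_cols_P: "distinct (cols P)" "0\<^sub>v (2 * k) \<notin> set (cols P)"
proof -
  \<comment> \<open>\<open>distinct_concat\<close> also asks that the blocks be different as lists;
    disjoint blocks are, because none is empty.\<close>
  have ne: "cols (F s) \<noteq> []" for s
    using F_carrier[of s] c by (metis carrier_matD(2) cols_length list.size(3) add_2_eq_Suc' not_less_eq_eq zero_le)
  have disj: "set (cols (F i)) \<inter> set (cols (F j)) = {}" if "i < c + 3" "j < c + 3" "i \<noteq> j" for i j
    using that cols_F_disjoint[of i j] cols_F_disjoint[of j i] by (metis Int_commute nat_neq_iff)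
  have "inj_on (\<lambda>s. cols (F s)) {0..<c + 3}"
  proof (rule inj_onI)
    fix i j assume ij: "i \<in> {0..<c + 3}" "j \<in> {0..<c + 3}" "cols (F i) = cols (F j)"
    show "i = j"
    proof (rule ccontr)
      assume "i \<noteq> j"
      then have "set (cols (F i)) \<inter> set (cols (F j)) = {}" using disj[of i j] ij(1,2) by simp
      then show False using ij(3) ne[of j] by simp
    qed
  qed
  then show "distinct (cols P)"
    unfolding cols_P using F_same_kernel(1) disj
    by (intro distinct_concat) (auto simp: distinct_map, metis disj disjoint_iff)
  show "0\<^sub>v (2 * k) \<notin> set (cols P)" using F_same_kernel(2) by (auto simp: cols_P)
qed

text \<open>The width is read off from \<open>card_U\<close>: the columns of \<open>P\<close> are
  distinct and nonzero, and together with 0 they form \<open>U\<close>.\<close>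

lemma P_carrier: "P \<in> carrier_mat (2 * k) ((c + 3) * n)"
proof -
  have "card U = (c + 3) * n + 1" using card_U n by simp
  moreover have "card U = Suc (length (cols P))"
    unfolding U_eq card_insert_disjoint[OF finite_set distinct_cols_P(2)]
      distinct_card[OF distinct_cols_P(1)] ..
  ultimately have "dim_col P = (c + 3) * n"
    unfolding cols_length by linarith
  moreover have "dim_row P = 2 * k"
    unfolding block_parity_check_eq mat_of_cols_carrier(2) using H by simp
  ultimately show ?thesis by (intro carrier_matI)
qed

end

text \<open>The added coordinate does not enter the checks of \<open>P\<close>, so it receives a
  zero column and appears only in the parity equation.\<close>

lemma extended_code_mat_kernel:
  assumes P: "P \<in> carrier_mat m p"
  shows "extended_code (mat_kernel P) = {y \<in> carrier_vec (p + 1).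
    mat_of_cols m (cols P @ [0\<^sub>v m]) *\<^sub>v y = 0\<^sub>v m \<and> (\<Sum>i<p + 1. y $ i) = 0}"
proof -
  let ?M = "mat_of_cols m (cols P @ [0\<^sub>v m])"
  have len: "length (cols P) = p" using P by simp
  have mult: "?M *\<^sub>v (x @\<^sub>v vec_of_list [a]) = P *\<^sub>v x" if x: "x \<in> carrier_vec p" for x a
  proof (rule eq_vecI)
    fix r assume "r < dim_vec (P *\<^sub>v x)"
    then have r: "r < m" using P by simp
    have "(?M *\<^sub>v (x @\<^sub>v vec_of_list [a])) $ r
        = (\<Sum>j<p + 1. ?M $$ (r, j) * (x @\<^sub>v vec_of_list [a]) $ j)"
      using r x P by (auto simp: scalar_prod_def atLeast0LessThan intro!: sum.cong)
    also have "\<dots> = (\<Sum>j<p. P $$ (r, j) * x $ j)"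
      using r x P len by (auto simp: mat_of_cols_index nth_append intro!: sum.cong)
    also have "\<dots> = (P *\<^sub>v x) $ r"
      using r x P by (auto simp: scalar_prod_def atLeast0LessThan intro!: sum.cong)
    finally show "(?M *\<^sub>v (x @\<^sub>v vec_of_list [a])) $ r = (P *\<^sub>v x) $ r" .
  qed (use P in simp)
  show ?thesis
  proof (rule Set.set_eqI, rule iffI)
    fix y assume "y \<in> extended_code (mat_kernel P)"
    then obtain x a where x: "x \<in> mat_kernel P" "y = x @\<^sub>v vec_of_list [a]"
        "(\<Sum>i<dim_vec y. y $ i) = 0"
      by (auto simp: extended_code_def)
    have xc: "x \<in> carrier_vec p" "P *\<^sub>v x = 0\<^sub>v m" using mat_kernelD[OF P x(1)] by auto
    then have "dim_vec y = p + 1" using x(2) by simp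
    then show "y \<in> {y \<in> carrier_vec (p + 1). ?M *\<^sub>v y = 0\<^sub>v m \<and> (\<Sum>i<p + 1. y $ i) = 0}"
      using x xc mult[OF xc(1), of a] by (auto intro: carrier_vecI)
  next
    fix y assume y: "y \<in> {y \<in> carrier_vec (p + 1). ?M *\<^sub>v y = 0\<^sub>v m \<and> (\<Sum>i<p + 1. y $ i) = 0}"
    define x where "x = vec p (\<lambda>i. y $ i)"
    have yx: "y = x @\<^sub>v vec_of_list [y $ p]"
      using y by (intro eq_vecI) (auto simp: x_def less_Suc_eq)
    have xc: "x \<in> carrier_vec p" by (simp add: x_def)
    have "P *\<^sub>v x = 0\<^sub>v m" using y mult[OF xc, of "y $ p"] yx by simp
    then have "x \<in> mat_kernel P" using P xc by (intro mat_kernelI)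
    moreover have "(\<Sum>i<dim_vec y. y $ i) = 0" using y by auto
    ultimately show "y \<in> extended_code (mat_kernel P)"
      unfolding extended_code_def using yx by blast
  qed
qed

section \<open>Regularity and parameters of the extended code\<close>

context cyclic_hamming
begin

sublocale parity_extension "2 * k" "(c + 3) * n + 1"
  "mat_of_cols (2 * k) (cols P @ [0\<^sub>v (2 * k)])" U "extended_code (mat_kernel P)"
proof
  let ?M = "mat_of_cols (2 * k) (cols P @ [0\<^sub>v (2 * k)])"
  have "set (cols P @ [0\<^sub>v (2 * k)]) \<subseteq> carrier_vec (2 * k)"
    using P_carrier cols_dim[of P] by auto
  then have colsM: "cols ?M = cols P @ [0\<^sub>v (2 * k)]" by (rule cols_mat_of_cols)
  show "?M \<in> carrier_mat (2 * k) ((c + 3) * n + 1)"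
    using P_carrier mat_of_cols_carrier(1)[of "2 * k" "cols P @ [0\<^sub>v (2 * k)]"] by simp
  show "distinct (cols ?M)" unfolding colsM using distinct_cols_P by simp
  show "U = set (cols ?M)" unfolding colsM U_eq by simp
  show "0\<^sub>v (2 * k) \<in> U" by (simp add: U_eq)
  show "\<exists>s\<in>U. \<exists>t\<in>U. g = s + t" if "g \<in> carrier_vec (2 * k)" for g
  proof -
    \<comment> \<open>The subspaces of blocks 0 and 1 are already complementary.\<close>
    have "\<exists>u\<in>insert (0\<^sub>v (2 * k)) (set (cols (F 0))).
        \<exists>v\<in>insert (0\<^sub>v (2 * k)) (set (cols (F 1))). g = u + v"
      by (rule ex_decomposition) (use that in simp_all)
    moreover have "insert (0\<^sub>v (2 * k)) (set (cols (F i))) \<subseteq> U" if "i \<le> 1" for i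
      by (rule W_subset_U) (use that in simp)
    ultimately show ?thesis by (meson le_refl subsetD zero_le_one)
  qed
  show "U \<noteq> carrier_vec (2 * k)"
  proof
    assume "U = carrier_vec (2 * k)"
    \<comment> \<open>Covering the whole space would take n + 2 subspaces, while c + 3 \<le> n +
      1.\<close>
    then have "(c + 3) * n + 1 = (n + 1) * (n + 1)"
      using card_U n card_carrier_vec_bit[of "2 * k"] by (simp add: mult_2 power_add)
    moreover have "(c + 3) * n \<le> (n + 1) * n" using c by (intro mult_right_mono) auto
    ultimately show False using c by (simp add: algebra_simps)
  qed
  show "extended_code (mat_kernel P) = {x \<in> carrier_vec ((c + 3) * n + 1).
      ?M *\<^sub>v x = 0\<^sub>v (2 * k) \<and> (\<Sum>i<(c + 3) * n + 1. x $ i) = 0}"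
    by (rule extended_code_mat_kernel[OF P_carrier])
qed

lemma reps_outside:
  assumes "g \<in> carrier_vec (2 * k)" "g \<notin> U"
  shows "reps g = (c + 3) * (c + 2)"
  unfolding reps_def card_differences_outside[OF assms] by simp

lemma reps_inside:
  assumes "g \<in> U" "g \<noteq> 0\<^sub>v (2 * k)"
  shows "reps g = 2 ^ k + (c + 2) * (c + 1)"
  unfolding reps_def card_differences_inside[OF assms] by simp

text \<open>Nonzero vectors exist both inside and outside \<open>U\<close>, so \<open>reps\<close>
  is constant exactly when the two counts agree.\<close>

lemma completely_regular_iff_c:
  assumes "k \<ge> 1"
  shows "completely_regular ((c + 3) * n + 1) (extended_code (mat_kernel P)) \<longleftrightarrow> c + 2 = 2 ^ (k - 1)"
proof -
  have q: "2 ^ k = 2 * (2 ^ (k - 1) :: nat)" using assms by (cases k) auto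
  \<comment> \<open>The two products differ by 2(c + 2), which is to equal 2^k.\<close>
  have eq: "2 ^ k + (c + 2) * (c + 1) = (c + 3) * (c + 2) \<longleftrightarrow> c + 2 = 2 ^ (k - 1)"
    unfolding q by (auto simp: algebra_simps)
  obtain g where g: "g \<in> carrier_vec (2 * k)" "g \<notin> U" using ex_not_T by auto
  have "U \<noteq> {0\<^sub>v (2 * k)}" using card_U c by (intro notI) (simp add: n)
  then obtain h where h: "h \<in> U" "h \<noteq> 0\<^sub>v (2 * k)"
    using zero_T by blast
  have gh: "g \<in> carrier_vec (2 * k) - {0\<^sub>v (2 * k)}" "h \<in> carrier_vec (2 * k) - {0\<^sub>v (2 * k)}"
    using g h zero_T T_carrier by blast+
  show ?thesis
    unfolding completely_regular_iff
  proof
    assume "\<exists>\<mu>. \<forall>g\<in>carrier_vec (2 * k) - {0\<^sub>v (2 * k)}. reps g = \<mu>"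
    then obtain \<mu> where \<mu>: "reps v = \<mu>" if "v \<in> carrier_vec (2 * k) - {0\<^sub>v (2 * k)}" for v
      by blast
    have "2 ^ k + (c + 2) * (c + 1) = reps h"
      by (rule reps_inside[OF h, symmetric])
    also have "\<dots> = reps g" by (simp only: \<mu>[OF gh(1)] \<mu>[OF gh(2)])
    also have "\<dots> = (c + 3) * (c + 2)" by (rule reps_outside[OF g])
    finally show "c + 2 = 2 ^ (k - 1)" by (simp only: eq)
  next
    assume "c + 2 = 2 ^ (k - 1)"
    then have inside: "reps g = (c + 3) * (c + 2)" if "g \<in> U" "g \<noteq> 0\<^sub>v (2 * k)" for g
      unfolding reps_inside[OF that] eq .
    have "reps g = (c + 3) * (c + 2)" if "g \<in> carrier_vec (2 * k) - {0\<^sub>v (2 * k)}" for g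
      using that by (cases "g \<in> U") (simp_all only: inside reps_outside Diff_iff singleton_iff simp_thms)
    then show "\<exists>\<mu>. \<forall>g\<in>carrier_vec (2 * k) - {0\<^sub>v (2 * k)}. reps g = \<mu>"
      by blast
  qed
qed

text \<open>Block 0 has n \<ge> 3 columns, hence two distinct nonzero ones, and their sum stays in
  the same subspace.\<close>

lemma minimum_distance_eq: "minimum_distance (extended_code (mat_kernel P)) = 4"
proof -
  have "3 \<le> length (cols (F 0))" using F_carrier[of 0] c by simp
  then obtain a b xs where ab: "cols (F 0) = a # b # xs"
    by (metis Suc_le_length_iff numeral_3_eq_3)
  let ?W = "insert (0\<^sub>v (2 * k)) (set (cols (F 0)))"
  have sub: "?W \<subseteq> U" by (rule W_subset_U) simp
  have "a \<noteq> b" "a \<noteq> 0\<^sub>v (2 * k)" "b \<noteq> 0\<^sub>v (2 * k)"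
    using F_same_kernel(1,2)[of 0] by (auto simp: ab)
  moreover have "a + b \<in> ?W" by (rule F_same_kernel(4)) (auto simp: ab)
  moreover have "a \<in> ?W" "b \<in> ?W" by (auto simp: ab)
  ultimately show ?thesis using sub by (intro minimum_distance_D[of a b]) auto
qed

end

theorem theorem3p1:
  fixes k n c :: nat and H :: "bit mat" and C :: "bit vec set"
  assumes "k \<ge> 1"
    and "n = 2 ^ k - 1"
    and "H \<in> carrier_mat k n"
    and "hamming_code k (mat_kernel H)"
    and "cyclic_code (mat_kernel H)"
    and "1 \<le> c" and "int c \<le> int n - 2"
    and "C = mat_kernel (block_parity_check H c)"
  shows "(completely_regular ((c + 3) * n + 1) (extended_code C) \<longleftrightarrow>
            int c = 2 ^ (k - 1) - 2) \<and>
         (int c = 2 ^ (k - 1) - 2 \<longrightarrow>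
            linear_code_params (extended_code C)
              (2 ^ (k - 1) * (2 ^ k + 1)) (2 ^ (k - 1) * (2 ^ k + 1) - 1 - 2 * k) 4 3 \<and>
            has_intersection_array (2 ^ (k - 1) * (2 ^ k + 1)) (extended_code C)
              [2 ^ (k - 1) * (2 ^ k + 1), 2 ^ (k - 1) * (2 ^ k + 1) - 1, 2 ^ (2 * k - 2)]
              [1, 2 ^ (k - 1) * (2 ^ (k - 1) + 1), 2 ^ (k - 1) * (2 ^ k + 1)])"
proof -
  have H: "H \<in> carrier_mat k (2 ^ k - 1)" using assms(2,3) by simp
  \<comment> \<open>The bound on \<open>c\<close> is stated over the integers to avoid truncated
    subtraction; this is its form over the naturals.\<close>
  have "c + 2 \<le> n" using assms(7) by linarith
  then interpret cyclic_hamming k n c H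
    using assms(2,3,5,6) hamming_code_columns[OF H assms(4)] by (intro cyclic_hamming.intro)
  have q: "2 ^ k = 2 * (2 ^ (k - 1) :: nat)" using assms(1) by (cases k) auto
  have "int c = 2 ^ (k - 1) - 2 \<longleftrightarrow> int (c + 2) = int (2 ^ (k - 1))" by auto
  then have int_c: "int c = 2 ^ (k - 1) - 2 \<longleftrightarrow> c + 2 = 2 ^ (k - 1)"
    by (simp only: of_nat_eq_iff)
  have "linear_code_params (extended_code C)
          (2 ^ (k - 1) * (2 ^ k + 1)) (2 ^ (k - 1) * (2 ^ k + 1) - 1 - 2 * k) 4 3 \<and>
        has_intersection_array (2 ^ (k - 1) * (2 ^ k + 1)) (extended_code C)
          [2 ^ (k - 1) * (2 ^ k + 1), 2 ^ (k - 1) * (2 ^ k + 1) - 1, 2 ^ (2 * k - 2)]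
          [1, 2 ^ (k - 1) * (2 ^ (k - 1) + 1), 2 ^ (k - 1) * (2 ^ k + 1)]"
    if c_eq: "c + 2 = 2 ^ (k - 1)"
  proof
    let ?N = "(c + 3) * n + 1" and ?\<mu> = "(c + 3) * (c + 2)"
    \<comment> \<open>From here all parameters are polynomials in \<open>c\<close>: the length is (c
      + 2)(2c + 5), \<open>?\<mu>\<close> is (c + 2)(c + 3), and their difference is (c +
      2)^2.\<close>
    have n_eq: "n = 2 * (c + 2) - 1" using assms(2) q c_eq by simp
    have N: "2 ^ (k - 1) * (2 ^ k + 1) = ?N"
      unfolding q c_eq[symmetric] n_eq by (simp add: algebra_simps)
    have \<mu>: "2 ^ (k - 1) * (2 ^ (k - 1) + 1) = ?\<mu>"
      unfolding c_eq[symmetric] by (simp add: algebra_simps)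
    have "2 ^ (2 * k - 2) = 2 ^ (k - 1) * (2 ^ (k - 1) :: nat)"
      by (simp flip: power_add add: mult_2)
    also have "\<dots> = ?N - ?\<mu>"
      unfolding c_eq[symmetric] n_eq by (simp add: algebra_simps)
    finally have b2: "2 ^ (2 * k - 2) = ?N - ?\<mu>" .
    have inside: "2 ^ k + (c + 2) * (c + 1) = ?\<mu>"
      unfolding q c_eq[symmetric] by (simp add: algebra_simps)
    have reps: "reps g = ?\<mu>" if "g \<in> carrier_vec (2 * k)" "g \<noteq> 0\<^sub>v (2 * k)" for g
      using reps_outside[OF that(1)] reps_inside[of g] inside that(2) by (cases "g \<in> U") simp_all
    show "linear_code_params (extended_code C)
        (2 ^ (k - 1) * (2 ^ k + 1)) (2 ^ (k - 1) * (2 ^ k + 1) - 1 - 2 * k) 4 3"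
      unfolding N linear_code_params_def assms(8)
      using linear_code_D minimum_distance_eq covering_radius_D by simp
    show "has_intersection_array (2 ^ (k - 1) * (2 ^ k + 1)) (extended_code C)
        [2 ^ (k - 1) * (2 ^ k + 1), 2 ^ (k - 1) * (2 ^ k + 1) - 1, 2 ^ (2 * k - 2)]
        [1, 2 ^ (k - 1) * (2 ^ (k - 1) + 1), 2 ^ (k - 1) * (2 ^ k + 1)]"
      unfolding N \<mu> b2 assms(8) by (rule has_intersection_array_D[OF reps])
  qed
  then show ?thesis
    using completely_regular_iff_c[OF assms(1)] int_c assms(8) by simp
qed

end
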